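(* Let $d_F>2$, $\delta=\frac{1}{d_F-1}$ and $\rho>1$. Consider a general hyperfractal street distribution of dimension $d_F$ and the search algorithm with parameter $\rho$ described in the context, and let $f(x)=\mathbb{E}[D(\mathcal{S}_1,\ldots,\mathcal{S}_k,\ldots)]$ be the expected distance driven before finding a free parking slot when the pop-up intensity on a segment $\mathcal{S}$ is $x\mu(\mathcal{S})$. Then $$f(x)=\Omega\left(x^{-1/d_F}\right)\qquad\text{as }x\to\infty,$$ i.e. there are $c>0$ and $x_0>0$ with $f(x)\ge c\,x^{-1/d_F}$ for all $x\ge x_0$.
   Context: Each street segment $\mathcal{S}$ has a normalized weight $\mu(\mathcal{S})\in(0,1]$, and free slots appear along it as a Poisson process of linear intensity $x\mu(\mathcal{S})$, $x>0$. Throughout, $\Theta(\cdot)$ means bounded above and below up to positive multiplicative constants, uniformly in all the variables. Search algorithm with parameter $\rho>1$: a car on a street of weight $\mu_i$ turns, if it has not yet parked, at the first intersection with a street of weight $\mu_{i-1}>\rho\mu_i$. The visited weights, enumerated from the largest to the smallest, are $\mu_1>\mu_2>\cdots$ (the last visited street being $\mathcal{S}_1$), and the segments $\mathcal{S}_i$ have random lengths $|\mathcal{S}_i|$. For a given sequence of segments, with $\lambda_i=x\mu_i$, the mean driven distance is $$D(\mathcal{S}_1,\ldots,\mathcal{S}_k)=\sum_{i=1}^{k}\frac{1-e^{-\lambda_i|\mathcal{S}_i|}}{\lambda_i}\prod_{j>i}e^{-\lambda_j|\mathcal{S}_j|}.$$ General hyperfractal properties: - The weights visited form a Markov chain (in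 the order of travel): given $\mu_i$, the next weight has density $p(\nu\mid\mu_i)=\Theta\left(\left(\nu/\mu_i\right)^{-\delta}\right)\frac1\nu$ for $\nu>\rho\mu_i$ and zero otherwise; equivalently to order of magnitude, $\mathbb{P}(\mu_{i-1}>\mu\mid\mu_i)=\Theta\left((\mu/\mu_i)^{-\delta}\right)$ for $\mu>\rho\mu_i$. The sequence of segments stops when the next weight would exceed $1$. - Given the sequence of weights, the lengths $|\mathcal{S}_i|$ are independent, the law of $|\mathcal{S}_i|$ depending only on $\mu_i$, with $\mathbb{E}[x\mu_i|\mathcal{S}_i|]=\Theta\left(x\mu_i^{\delta+1}\right)$ and $\mathbb{E}\left[1-e^{-x\mu_i|\mathcal{S}_i|}\right]=\Theta\left(\eta(x\mu_i^{\delta+1})\right)$ for some bounded function $\eta$ on $(0,\infty)$. The function $f(x)=\mathbb{E}[D(\mathcal{S}_1,\ldots,\mathcal{S}_k,\ldots)]$ is the limit (assumed to exist) of the expected mean driven distance when the weight of the starting street tends to $0$. *)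

theory Defs
  imports "HOL-Probability.Probability"
begin

text \<open>Uniform \<open>\<Theta>\<close> on a set of variables: unlike the Landau symbols, no limit is involved.\<close>

definition unif_theta :: "'v set \<Rightarrow> ('v \<Rightarrow> real) \<Rightarrow> ('v \<Rightarrow> real) \<Rightarrow> bool" where
  "unif_theta S f g \<longleftrightarrow> (\<exists>c>0. \<exists>C>0. \<forall>v\<in>S. c * g v \<le> f v \<and> f v \<le> C * g v)"

text \<open>
  \<open>p \<nu> \<mu>\<close> is the conditional density \<open>p(\<nu> | \<mu>)\<close> of the next weight \<open>\<nu>\<close> given the current
  weight \<open>\<mu>\<close>; it is a probability density on the whole half-line above \<open>\<rho> \<mu>\<close>, a value above 1
  meaning that the search path ends.  \<open>\<Lambda> \<mu>\<close> is the law of the length of a visited segment of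
  weight \<open>\<mu>\<close>.  In \<open>length_mean\<close> the positive lower bound forces integrability.
\<close>

locale hyperfractal_laws =
  fixes \<delta> \<rho> :: real
    and p :: "real \<Rightarrow> real \<Rightarrow> real"
    and \<Lambda> :: "real \<Rightarrow> real measure"
    and \<eta> :: "real \<Rightarrow> real"
  assumes density_measurable:
      "(\<lambda>(\<nu>, \<mu>). p \<nu> \<mu>) \<in> borel_measurable (borel \<Otimes>\<^sub>M restrict_space borel {0<..1})"
    and density_total:
      "\<And>\<mu>. \<mu> \<in> {0<..1} \<Longrightarrow> (\<integral>\<^sup>+ \<nu>. ennreal (p \<nu> \<mu>) \<partial>lborel) = 1"
    and density_theta:
      "unif_theta {(\<nu>, \<mu>). \<mu> \<in> {0<..1} \<and> \<nu> > \<rho> * \<mu>}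
         (\<lambda>(\<nu>, \<mu>). p \<nu> \<mu>) (\<lambda>(\<nu>, \<mu>). (\<nu> / \<mu>) powr (- \<delta>) * (1 / \<nu>))"
    and density_zero:
      "\<And>\<mu> \<nu>. \<mu> \<in> {0<..1} \<Longrightarrow> \<nu> \<le> \<rho> * \<mu> \<Longrightarrow> p \<nu> \<mu> = 0"
    and length_kernel:
      "\<Lambda> \<in> restrict_space borel {0<..1} \<rightarrow>\<^sub>M prob_algebra borel"
    and length_nonneg:
      "\<And>\<mu>. \<mu> \<in> {0<..1} \<Longrightarrow> AE l in \<Lambda> \<mu>. 0 \<le> l"
    and length_mean:
      "unif_theta ({0<..} \<times> {0<..1})
         (\<lambda>(x, \<mu>). \<integral>l. x * \<mu> * l \<partial>\<Lambda> \<mu>) (\<lambda>(x, \<mu>). x * \<mu> powr (\<delta> + 1))"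
    and eta_bounded: "bounded (\<eta> ` {0<..})"
    and length_parking:
      "unif_theta ({0<..} \<times> {0<..1})
         (\<lambda>(x, \<mu>). \<integral>l. 1 - exp (- (x * \<mu> * l)) \<partial>\<Lambda> \<mu>) (\<lambda>(x, \<mu>). \<eta> (x * \<mu> powr (\<delta> + 1)))"

text \<open>
  The weights are recorded in the order of travel as a Markov chain on the reals in which the
  value 0 (not a weight) means that the path has ended: a next weight above 1 is replaced by 0,
  and 0 is absorbing.
\<close>

definition next_weight_law :: "(real \<Rightarrow> real \<Rightarrow> real) \<Rightarrow> real \<Rightarrow> real measure" where
  "next_weight_law p \<mu> =
     (if \<mu> > 0
      then distr (density lborel (\<lambda>\<nu>. ennreal (p \<nu> \<mu>))) borel (\<lambda>\<nu>. if \<nu> \<le> 1 then \<nu> else 0)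
      else return borel 0)"

definition history :: "'a measure \<Rightarrow> (nat \<Rightarrow> 'a \<Rightarrow> real) \<Rightarrow> nat set \<Rightarrow> 'a measure" where
  "history M V I =
     vimage_algebra (space M) (\<lambda>\<omega>. \<lambda>i\<in>I. V i \<omega>) (Pi\<^sub>M I (\<lambda>_. borel))"

text \<open>
  \<open>V n\<close> and \<open>L n\<close> are the weight and the length of the \<open>n\<close>-th visited segment (counted from 0, in
  the order of travel) of a search starting on a street of weight \<open>m\<close>.  Given the whole sequence of
  weights, the lengths of the existing segments are independent with laws \<open>\<Lambda> (V i)\<close>; as 0 is
  absorbing, \<open>V n \<omega> > 0\<close> says that segments \<open>0, \<dots>, n\<close> all exist.
\<close>

locale search_path = prob_space M
  for M :: "'a measure" +
  fixes p :: "real \<Rightarrow> real \<Rightarrow> real"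
    and \<Lambda> :: "real \<Rightarrow> real measure"
    and m :: real
    and V L :: "nat \<Rightarrow> 'a \<Rightarrow> real"
  assumes weight_measurable: "\<And>n. random_variable borel (V n)"
    and length_measurable: "\<And>n. random_variable borel (L n)"
    and start: "AE \<omega> in M. V 0 \<omega> = m"
    and markov:
      "\<And>n B. B \<in> sets borel \<Longrightarrow>
         AE \<omega> in M. real_cond_exp M (history M V {..n})
             (indicator {\<omega> \<in> space M. V (Suc n) \<omega> \<in> B}) \<omega>
           = measure (next_weight_law p (V n \<omega>)) B"
    and lengths:
      "\<And>n B. (\<And>i. B i \<in> sets borel) \<Longrightarrow>
         AE \<omega> in M. V n \<omega> > 0 \<longrightarrow>
           real_cond_exp M (history M V UNIV)
             (indicator {\<omega> \<in> space M. \<forall>i\<le>n. L i \<omega> \<in> B i}) \<omega>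
           = (\<Prod>i\<le>n. measure (\<Lambda> (V i \<omega>)) (B i))"

text \<open>
  \<open>D(S\<^sub>1, \<dots>, S\<^sub>k)\<close> for segments of weights \<open>\<mu> i\<close> and lengths \<open>l i\<close>, \<open>i = 1, \<dots>, k\<close>, where \<open>S\<^sub>1\<close> is
  the last visited one.
\<close>

definition driven_distance ::
  "real \<Rightarrow> nat \<Rightarrow> (nat \<Rightarrow> real) \<Rightarrow> (nat \<Rightarrow> real) \<Rightarrow> real" where
  "driven_distance x k \<mu> l =
     (\<Sum>i = 1..k. (1 - exp (- (x * \<mu> i) * l i)) / (x * \<mu> i)
        * (\<Prod>j = i+1..k. exp (- (x * \<mu> j) * l j)))"

definition num_segments :: "(nat \<Rightarrow> 'a \<Rightarrow> real) \<Rightarrow> 'a \<Rightarrow> nat" where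
  "num_segments V \<omega> = (LEAST n. V n \<omega> = 0)"

text \<open>The index \<open>num_segments V \<omega> - i\<close> converts the order of travel into the decreasing order of
  weights.\<close>

definition path_distance ::
  "real \<Rightarrow> (nat \<Rightarrow> 'a \<Rightarrow> real) \<Rightarrow> (nat \<Rightarrow> 'a \<Rightarrow> real) \<Rightarrow> 'a \<Rightarrow> real" where
  "path_distance x V L \<omega> =
     driven_distance x (num_segments V \<omega>)
       (\<lambda>i. V (num_segments V \<omega> - i) \<omega>) (\<lambda>i. L (num_segments V \<omega> - i) \<omega>)"

end

theory Submission
  imports Defs
begin

text \<open>
  The mean number of free slots on a visited segment of weight \<open>\<mu>\<close> is of order \<open>x * \<mu> powr (\<delta> + 1)\<close>. It
  is of order 1 at the critical weight \<open>u = x powr (- 1 / (\<delta> + 1))\<close>. A car that parks on a segment of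
  weight comparable to \<open>u\<close> has a mean distance of order \<open>1 / (x * u)\<close> to drive there, and
  \<open>1 / (x * u) = x powr (- \<delta> / (\<delta> + 1)) = x powr (- 1 / d\<^sub>F)\<close>. So it suffices that the car parks at such a
  weight with a probability that is bounded below, uniformly in the intensity and in the starting
  weight. Three facts give this.

  First, the weight chain grows until it ends, hence it crosses the level \<open>u\<close>; and because the jump
  density is, up to constants, a power law and so invariant under scaling, each crossing lands in the window
  \<open>{u<..2 * \<rho> * u}\<close> with conditional probability at least a constant \<open>q\<close>
  (\<open>crossing_lands_in_window\<close>, \<open>sum_crossing_ge_1\<close>). Secondly, the weights below \<open>u\<close> are dominated by a
  geometric sequence of ratio \<open>1 / \<rho>\<close> that ends at \<open>u\<close>, so on all earlier segments together the car
  meets a bounded mean number of free slots; by Jensen's inequality it reaches the window with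
  probability bounded below (\<open>weight_path_energy_le\<close>, \<open>not_parking_probability_ge\<close>). Thirdly, above \<open>u\<close>
  the parking probability on a segment is bounded below, because \<open>\<eta>\<close> is bounded below on \<open>{1..}\<close>
  (\<open>parking_probability_ge\<close>).

  The three estimates multiply because the lengths are independent given the weights
  (\<open>nn_integral_lengths\<close>), and all the terms of the driven distance that are dropped are nonnegative
  (\<open>AE_path_distance_ge\<close>). The bound for a starting weight \<open>m < u\<close> does not depend on \<open>m\<close>, so it passes
  to the limit \<open>m \<rightarrow> 0\<close>.
\<close>

section \<open>From conditional expectations to integrals\<close>

lemma (in prob_space) subalgebra_history:
  assumes "\<And>i. i \<in> I \<Longrightarrow> V i \<in> borel_measurable M"
  shows "subalgebra M (history M V I)"
  unfolding subalgebra_def history_def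
  by (intro conjI sets_image_in_sets measurable_restrict assms) simp_all

lemma measurable_history:
  assumes "i \<in> I"
  shows "V i \<in> borel_measurable (history M V I)"
proof -
  have "(\<lambda>\<omega>. \<lambda>i\<in>I. V i \<omega>) \<in> history M V I \<rightarrow>\<^sub>M Pi\<^sub>M I (\<lambda>_. borel)"
    unfolding history_def by (rule measurable_vimage_algebra1) (auto simp: space_PiM)
  from measurable_compose[OF this measurable_component_singleton[OF assms]]
  show ?thesis using assms by simp
qed

text \<open>
  The defining property of a conditional probability \<open>K = P(E | F)\<close>, as an identity of nonnegative
  integrals. Agreement on \<open>A\<close> is the form that applies to the lengths, whose conditional law is given
  only on the event that the segments exist.
\<close>

lemma (in prob_space) nn_integral_conditional_probability:
  assumes F: "subalgebra M F" and E: "E \<in> events" and A: "A \<in> sets F"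
    and K: "AE \<omega> in M. \<omega> \<in> A \<longrightarrow> real_cond_exp M F (indicator E) \<omega> = K \<omega>"
  shows "emeasure M (A \<inter> E) = (\<integral>\<^sup>+\<omega>. indicator A \<omega> * ennreal (K \<omega>) \<partial>M)"
proof -
  interpret finite_measure_subalgebra M F
    by unfold_locales (fact F)
  have AM: "A \<in> events" using A F by (auto simp: subalgebra_def)
  have int: "integrable M (indicator E :: 'a \<Rightarrow> real)"
    using E by (simp add: emeasure_eq_measure)
  have pos: "AE \<omega> in M. 0 \<le> real_cond_exp M F (indicator E) \<omega>"
    by (rule real_cond_exp_pos) (use E in auto)
  have int2: "integrable M (\<lambda>\<omega>. indicator A \<omega> * real_cond_exp M F (indicator E) \<omega>)"
    using integrable_mult_indicator[OF AM real_cond_exp_int(1)[OF int]] by simp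
  have "(\<integral>\<^sup>+\<omega>. indicator A \<omega> * ennreal (K \<omega>) \<partial>M)
      = (\<integral>\<^sup>+\<omega>. ennreal (indicator A \<omega> * real_cond_exp M F (indicator E) \<omega>) \<partial>M)"
    using K by (intro nn_integral_cong_AE) (auto simp: indicator_def)
  also have "\<dots> = ennreal (\<integral>\<omega>. indicator A \<omega> * real_cond_exp M F (indicator E) \<omega> \<partial>M)"
    using pos by (intro nn_integral_eq_integral int2) (auto simp: indicator_def)
  also have "\<dots> = ennreal (\<integral>\<omega>. indicator A \<omega> * indicator E \<omega> \<partial>M)"
    using real_cond_exp_intA[OF int A] by (simp add: set_lebesgue_integral_def)
  also have "\<dots> = emeasure M (A \<inter> E)"
    using AM E by (subst indicator_inter_arith[symmetric]) (simp add: emeasure_eq_measure)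
  finally show ?thesis by simp
qed

text \<open>
  If \<open>K\<close> is a conditional law of \<open>Y\<close> given \<open>X\<close> as far as indicators of rectangles can tell, then
  conditional expectations of all \<open>\<phi> (X, Y)\<close> are integrals of \<open>\<phi>\<close> against \<open>K\<close>: both sides are
  integrals of \<open>\<phi>\<close> against a finite measure on the plane, and rectangles are an
  intersection-stable generator. This is needed because the parking probability
  \<open>1 - exp (- x * \<mu> * l)\<close> couples the weight and the length of a segment, whereas the conditional law
  of the lengths is given for fixed sets of lengths. The weights \<open>w1\<close> and \<open>w2\<close> carry the remaining
  segments, so that one segment can be treated at a time.
\<close>

lemma nn_integral_kernel_extension:
  fixes X Y :: "'a \<Rightarrow> real" and w1 w2 :: "'a \<Rightarrow> ennreal" and K :: "real \<Rightarrow> real measure"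
  assumes [measurable]: "X \<in> borel_measurable M" "Y \<in> borel_measurable M"
      "w1 \<in> borel_measurable M" "w2 \<in> borel_measurable M"
    and K: "K \<in> borel \<rightarrow>\<^sub>M prob_algebra borel"
    and fin: "(\<integral>\<^sup>+\<omega>. w1 \<omega> \<partial>M) \<noteq> \<infinity>"
    and eq: "\<And>C B. C \<in> sets borel \<Longrightarrow> B \<in> sets borel \<Longrightarrow>
       (\<integral>\<^sup>+\<omega>. w1 \<omega> * indicator C (X \<omega>) * indicator B (Y \<omega>) \<partial>M)
       = (\<integral>\<^sup>+\<omega>. w2 \<omega> * indicator C (X \<omega>) * emeasure (K (X \<omega>)) B \<partial>M)"
    and \<phi>[measurable]: "\<phi> \<in> borel_measurable (borel \<Otimes>\<^sub>M borel)"
  shows "(\<integral>\<^sup>+\<omega>. w1 \<omega> * \<phi> (X \<omega>, Y \<omega>) \<partial>M)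
       = (\<integral>\<^sup>+\<omega>. w2 \<omega> * (\<integral>\<^sup>+l. \<phi> (X \<omega>, l) \<partial>K (X \<omega>)) \<partial>M)"
proof -
  have K'[measurable]: "K \<in> borel \<rightarrow>\<^sub>M subprob_algebra borel"
    by (rule measurable_prob_algebraD[OF K])
  have setsK[simp, measurable_cong]: "sets (K u) = sets borel" for u
    using sets_kernel[OF K'] by simp
  define N1 where "N1 = distr (density M w1) (borel \<Otimes>\<^sub>M borel) (\<lambda>\<omega>. (X \<omega>, Y \<omega>))"
  define J where "J = (\<lambda>u. distr (K u) (borel \<Otimes>\<^sub>M borel) (\<lambda>l. (u, l)))"
  have J[measurable]: "J \<in> borel \<rightarrow>\<^sub>M subprob_algebra (borel \<Otimes>\<^sub>M borel)"
    unfolding J_def by (rule measurable_distr2[OF _ K']) measurable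
  define N2 where "N2 = distr (density M w2) borel X \<bind> J"
  have N1_int: "integral\<^sup>N N1 h = (\<integral>\<^sup>+\<omega>. w1 \<omega> * h (X \<omega>, Y \<omega>) \<partial>M)"
    if [measurable]: "h \<in> borel_measurable (borel \<Otimes>\<^sub>M borel)" for h
    unfolding N1_def by (simp add: nn_integral_distr nn_integral_density)
  have N2_int: "integral\<^sup>N N2 h = (\<integral>\<^sup>+\<omega>. w2 \<omega> * (\<integral>\<^sup>+l. h (X \<omega>, l) \<partial>K (X \<omega>)) \<partial>M)"
    if [measurable]: "h \<in> borel_measurable (borel \<Otimes>\<^sub>M borel)" for h
  proof -
    have Jh: "(\<lambda>u. integral\<^sup>N (J u) h) = (\<lambda>u. \<integral>\<^sup>+l. h (u, l) \<partial>K u)"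
      unfolding J_def by (intro ext nn_integral_distr) measurable
    have [measurable]: "(\<lambda>u. integral\<^sup>N (J u) h) \<in> borel_measurable borel"
      by (rule nn_integral_measurable_subprob_algebra2[OF _ J]) measurable
    have "integral\<^sup>N N2 h = (\<integral>\<^sup>+u. integral\<^sup>N (J u) h \<partial>distr (density M w2) borel X)"
      unfolding N2_def by (rule nn_integral_bind[where B = "borel \<Otimes>\<^sub>M borel"]) auto
    also have "\<dots> = (\<integral>\<^sup>+\<omega>. w2 \<omega> * integral\<^sup>N (J (X \<omega>)) h \<partial>M)"
      by (simp add: nn_integral_distr nn_integral_density)
    finally show ?thesis using Jh by (simp add: fun_eq_iff)
  qed
  \<comment> \<open>Both are laws of the pair: \<open>N1\<close> under the weight \<open>w1\<close>, \<open>N2\<close> with \<open>X\<close> under \<open>w2\<close> and then \<open>Y\<close> drawn from \<open>K X\<close>.\<close>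
  have "N1 = N2"
  proof (rule measure_eqI_generator_eq[OF Int_stable_pair_measure_generator[of borel borel],
        where \<Omega> = "UNIV" and A = "\<lambda>_. UNIV \<times> UNIV"])
    show "emeasure N1 Z = emeasure N2 Z"
      if Z: "Z \<in> {a \<times> b |a b. a \<in> sets borel \<and> b \<in> sets borel}" for Z
    proof -
      obtain C B where CB[measurable]: "C \<in> sets borel" "B \<in> sets borel" and ZCB: "Z = C \<times> B"
        using Z by auto
      have m: "indicator Z \<in> borel_measurable (borel \<Otimes>\<^sub>M borel)" unfolding ZCB by measurable
      have s: "Z \<in> sets N1" "Z \<in> sets N2"
        unfolding ZCB N1_def N2_def by (auto simp: sets_bind[OF sets_kernel[OF J]])
      have "emeasure N1 Z = (\<integral>\<^sup>+\<omega>. w1 \<omega> * indicator C (X \<omega>) * indicator B (Y \<omega>) \<partial>M)"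
        using N1_int[OF m] s by (simp add: ZCB indicator_times mult.assoc)
      also have "\<dots> = (\<integral>\<^sup>+\<omega>. w2 \<omega> * indicator C (X \<omega>) * emeasure (K (X \<omega>)) B \<partial>M)"
        by (rule eq) auto
      also have "\<dots> = emeasure N2 Z"
        using N2_int[OF m] s by (simp add: ZCB indicator_times mult.assoc nn_integral_cmult)
      finally show ?thesis .
    qed
    show "sets N1 = sigma_sets UNIV {a \<times> b |a b. a \<in> sets borel \<and> b \<in> sets borel}"
      unfolding N1_def by (simp add: sets_pair_measure)
    show "sets N2 = sigma_sets UNIV {a \<times> b |a b. a \<in> sets borel \<and> b \<in> sets borel}"
      unfolding N2_def by (simp add: sets_bind[OF sets_kernel[OF J]]) (simp add: sets_pair_measure)
    show "emeasure N1 (UNIV \<times> UNIV) \<noteq> \<infinity>" for i :: nat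
      using N1_int[of "\<lambda>_. 1"] fin by (simp add: N1_def space_pair_measure)
    show "range (\<lambda>_::nat. UNIV \<times> UNIV) \<subseteq> {a \<times> b |a b. a \<in> sets borel \<and> b \<in> sets (borel :: real measure)}"
      by (intro subsetI CollectI exI[of _ UNIV]) auto
  qed simp_all
  then show ?thesis using N1_int[OF \<phi>] N2_int[OF \<phi>] by simp
qed

section \<open>The weight chain and the laws of the lengths\<close>

locale hyperfractal_model = hyperfractal_laws +
  assumes delta_pos: "0 < \<delta>" and rho_gt_1: "1 < \<rho>"
begin

lemma density_measurable_section:
  assumes \<mu>: "\<mu> \<in> {0<..1}"
  shows "(\<lambda>\<nu>. p \<nu> \<mu>) \<in> borel_measurable borel"
proof -
  have "(\<lambda>\<nu>. (\<nu>, \<mu>)) \<in> borel \<rightarrow>\<^sub>M borel \<Otimes>\<^sub>M restrict_space borel {0<..1}"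
    using \<mu> by (intro measurable_Pair) (auto simp: space_restrict_space)
  from measurable_compose[OF this density_measurable] show ?thesis by simp
qed

lemma emeasure_next_weight_law:
  assumes \<mu>: "\<mu> \<in> {0<..1}" and B[measurable]: "B \<in> sets borel"
  shows "emeasure (next_weight_law p \<mu>) B
    = (\<integral>\<^sup>+\<nu>. ennreal (p \<nu> \<mu>) * indicator B (if \<nu> \<le> 1 then \<nu> else 0) \<partial>lborel)"
proof -
  note [measurable] = density_measurable_section[OF \<mu>]
  have "emeasure (next_weight_law p \<mu>) B = (\<integral>\<^sup>+\<nu>. indicator B \<nu> \<partial>next_weight_law p \<mu>)"
    by (rule nn_integral_indicator[symmetric]) (simp add: next_weight_law_def)
  also have "\<dots> = (\<integral>\<^sup>+\<nu>. ennreal (p \<nu> \<mu>) * indicator B (if \<nu> \<le> 1 then \<nu> else 0) \<partial>lborel)"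
    using \<mu> by (simp add: next_weight_law_def nn_integral_distr nn_integral_density del: nn_integral_indicator)
  finally show ?thesis .
qed

lemma prob_space_next_weight_law:
  assumes \<mu>: "\<mu> \<in> {0<..1}"
  shows "prob_space (next_weight_law p \<mu>)"
proof
  have "space (next_weight_law p \<mu>) = UNIV" by (simp add: next_weight_law_def)
  then show "emeasure (next_weight_law p \<mu>) (space (next_weight_law p \<mu>)) = 1"
    using emeasure_next_weight_law[OF \<mu>, of UNIV] density_total[OF \<mu>] by simp
qed

text \<open>
  Values that one step of the chain avoids. The point 0 is excluded from \<open>B\<close>, since it collects the
  mass of all raw next weights above 1.
\<close>

lemma next_weight_law_null:
  assumes \<mu>: "\<mu> \<in> {0<..1}" and B: "B \<in> sets borel"
    and above: "\<And>\<nu>. \<nu> \<in> B \<Longrightarrow> 0 < \<nu> \<and> \<nu> \<le> \<rho> * \<mu> \<or> \<nu> < 0 \<or> 1 < \<nu>"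
  shows "measure (next_weight_law p \<mu>) B = 0"
proof -
  have "ennreal (p \<nu> \<mu>) * indicator B (if \<nu> \<le> 1 then \<nu> else 0) = 0" for \<nu>
  proof (cases "\<nu> \<le> \<rho> * \<mu>")
    case True
    then show ?thesis using density_zero[OF \<mu> True] by simp
  next
    case False
    moreover have "0 < \<rho> * \<mu>" using \<mu> rho_gt_1 by simp
    ultimately show ?thesis
      using above[of \<nu>] above[of 0] by (auto simp: indicator_def)
  qed
  then have "emeasure (next_weight_law p \<mu>) B = 0"
    unfolding emeasure_next_weight_law[OF \<mu> B] by (simp only: nn_integral_const) simp
  then show ?thesis by (simp add: measure_def)
qed

text \<open>
  A total version of the kernel \<open>\<Lambda>\<close>, so that it can be composed with the weight \<open>V i\<close>, which takes the
  value 0 once the path has ended.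
\<close>

definition length_law :: "real \<Rightarrow> real measure" where
  "length_law \<mu> = (if \<mu> \<in> {0<..1} then \<Lambda> \<mu> else return borel 0)"

lemma length_law_eq: "\<mu> \<in> {0<..1} \<Longrightarrow> length_law \<mu> = \<Lambda> \<mu>"
  by (simp add: length_law_def)

lemma length_law_measurable: "length_law \<in> borel \<rightarrow>\<^sub>M prob_algebra borel"
  unfolding length_law_def
  using length_kernel
  by (subst measurable_If_restrict_space_iff)
     (auto simp: greaterThanAtMost_def greaterThan_def atMost_def Int_def space_prob_algebra prob_space_return)

lemma length_law_in_prob_algebra: "length_law \<mu> \<in> space (prob_algebra borel)"
  using measurable_space[OF length_law_measurable, of \<mu>] by simp

lemma prob_space_length_law: "prob_space (length_law \<mu>)"
  and sets_length_law [simp, measurable_cong]: "sets (length_law \<mu>) = sets borel"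
  and space_length_law [simp]: "space (length_law \<mu>) = UNIV"
  using length_law_in_prob_algebra[of \<mu>] by (auto simp: space_prob_algebra dest: sets_eq_imp_space_eq)

end

locale hyperfractal_search =
  hyperfractal_model \<delta> \<rho> p \<Lambda> \<eta> + search_path M p \<Lambda> m V L
  for \<delta> \<rho> p \<Lambda> \<eta> and M :: "'a measure" and m V L +
  assumes start_in: "m \<in> {0<..1}"
begin

declare weight_measurable [measurable] length_measurable [measurable]

lemma in_weight_history:
  assumes "\<And>\<omega>. \<omega> \<in> space M \<Longrightarrow> \<omega> \<in> A \<longleftrightarrow> V i \<omega> \<in> B" "A \<subseteq> space M" "i \<in> I" "B \<in> sets borel"
  shows "A \<in> sets (history M V I)"
proof -
  have "A = V i -` B \<inter> space (history M V I)"
    using assms(1,2) by (auto simp: history_def)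
  then show ?thesis using measurable_sets[OF measurable_history[OF assms(3)] assms(4)] by simp
qed

lemma emeasure_next_weight:
  assumes A: "A \<in> sets (history M V {..n})" and B[measurable]: "B \<in> sets borel"
  shows "emeasure M (A \<inter> {\<omega> \<in> space M. V (Suc n) \<omega> \<in> B})
    = (\<integral>\<^sup>+\<omega>. indicator A \<omega> * ennreal (measure (next_weight_law p (V n \<omega>)) B) \<partial>M)"
  by (rule nn_integral_conditional_probability[OF subalgebra_history _ A])
     (use markov[OF B, of n] in auto)

lemma AE_next_weight_notin:
  assumes A[measurable]: "A \<in> sets borel" and B[measurable]: "B \<in> sets borel"
    and null: "\<And>\<mu>. \<mu> \<in> A \<Longrightarrow> measure (next_weight_law p \<mu>) B = 0"
  shows "AE \<omega> in M. V n \<omega> \<in> A \<longrightarrow> V (Suc n) \<omega> \<notin> B"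
proof -
  let ?A = "{\<omega> \<in> space M. V n \<omega> \<in> A}"
  have "?A \<in> sets (history M V {..n})" by (rule in_weight_history) auto
  from emeasure_next_weight[OF this B] null
  have "emeasure M (?A \<inter> {\<omega> \<in> space M. V (Suc n) \<omega> \<in> B}) = 0"
    by (auto simp: indicator_def intro!: nn_integral_zero')
  then have "?A \<inter> {\<omega> \<in> space M. V (Suc n) \<omega> \<in> B} \<in> null_sets M" by auto
  from AE_not_in[OF this] show ?thesis by (auto elim!: AE_mp intro!: AE_I2)
qed

lemma measure_next_weight_zero: "B \<in> sets borel \<Longrightarrow> measure (next_weight_law p 0) B = indicator B 0"
  by (simp add: next_weight_law_def measure_return)

lemma AE_weight_range: "AE \<omega> in M. V n \<omega> \<in> {0..1}"
proof (induction n)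
  case 0
  show ?case using start by eventually_elim (use start_in in auto)
next
  case (Suc n)
  have "AE \<omega> in M. V n \<omega> \<in> {0..1} \<longrightarrow> V (Suc n) \<omega> \<notin> - {0..1}"
  proof (rule AE_next_weight_notin)
    fix \<mu> :: real assume "\<mu> \<in> {0..1}"
    then show "measure (next_weight_law p \<mu>) (- {0..1}) = 0"
      by (cases "\<mu> = 0") (auto simp: measure_next_weight_zero intro!: next_weight_law_null)
  qed auto
  with Suc show ?case by eventually_elim auto
qed

lemma AE_absorbed: "AE \<omega> in M. V n \<omega> = 0 \<longrightarrow> V (Suc n) \<omega> = 0"
  using AE_next_weight_notin[of "{0}" "- {0}" n] by (simp add: measure_next_weight_zero)

text \<open>
  Since the excluded set \<open>{0<..<\<rho> * V n}\<close> depends on the current weight, it is covered by the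
  countably many excluded sets \<open>{0<..r}\<close> with a rational \<open>r < \<rho> * V n\<close>.
\<close>

lemma AE_weight_growth: "AE \<omega> in M. 0 < V n \<omega> \<longrightarrow> 0 < V (Suc n) \<omega> \<longrightarrow> \<rho> * V n \<omega> \<le> V (Suc n) \<omega>"
proof -
  have "AE \<omega> in M. \<forall>r\<in>\<rat>. V n \<omega> \<in> {0<..1} \<inter> {\<mu>. r < \<rho> * \<mu>} \<longrightarrow> V (Suc n) \<omega> \<notin> {0<..r}"
  proof (rule AE_ball_countable')
    fix r :: real
    show "AE \<omega> in M. V n \<omega> \<in> {0<..1} \<inter> {\<mu>. r < \<rho> * \<mu>} \<longrightarrow> V (Suc n) \<omega> \<notin> {0<..r}"
      by (rule AE_next_weight_notin) (auto intro!: next_weight_law_null)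
  qed (rule countable_rat)
  with AE_weight_range[of n] show ?thesis
  proof eventually_elim
    case (elim \<omega>)
    show ?case
    proof (intro impI leI notI)
      assume pos: "0 < V n \<omega>" "0 < V (Suc n) \<omega>" and less: "V (Suc n) \<omega> < \<rho> * V n \<omega>"
      from Rats_dense_in_real[OF less] obtain r where "r \<in> \<rat>" "V (Suc n) \<omega> < r" "r < \<rho> * V n \<omega>" by auto
      with elim pos show False by force
    qed
  qed
qed

end

text \<open>
  The properties of a trajectory of the weight chain that hold almost surely and suffice for all
  pathwise arguments.
\<close>

definition weight_path :: "real \<Rightarrow> real \<Rightarrow> (nat \<Rightarrow> real) \<Rightarrow> bool" where
  "weight_path \<rho> m v \<longleftrightarrow> v 0 = m \<and> (\<forall>n. v n \<in> {0..1} \<and> (v n = 0 \<longrightarrow> v (Suc n) = 0)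
     \<and> (0 < v n \<longrightarrow> 0 < v (Suc n) \<longrightarrow> \<rho> * v n \<le> v (Suc n)))"

lemma (in hyperfractal_search) AE_weight_path: "AE \<omega> in M. weight_path \<rho> m (\<lambda>n. V n \<omega>)"
  unfolding weight_path_def
  using start AE_weight_range AE_absorbed AE_weight_growth by (simp add: AE_all_countable)

lemma weight_path_growth:
  assumes v: "weight_path \<rho> m v" and "1 < \<rho>" and "0 < v (i + k)"
  shows "0 < v i \<and> \<rho> ^ k * v i \<le> v (i + k)"
  using assms(3)
proof (induction k)
  case (Suc k)
  have z: "v (i + k) \<noteq> 0" using v Suc.prems unfolding weight_path_def by (metis add_Suc_right less_irrefl)
  have "0 \<le> v (i + k)" using v unfolding weight_path_def by auto
  with z have pos: "0 < v (i + k)" by simp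
  with v Suc.prems have "\<rho> * v (i + k) \<le> v (i + Suc k)" unfolding weight_path_def by auto
  moreover have "\<rho> * (\<rho> ^ k * v i) \<le> \<rho> * v (i + k)"
    using Suc.IH[OF pos] assms(2) by (intro mult_left_mono) auto
  ultimately show ?case using Suc.IH[OF pos] by (simp add: mult.assoc)
qed auto

text \<open>
  The weights grow geometrically and stay below 1, so the number of segments is bounded by a
  constant that depends only on \<open>\<rho>\<close> and the starting weight.
\<close>

lemma weight_path_positive_iff:
  assumes "weight_path \<rho> m v" "1 < \<rho>" "0 < m" "1 < \<rho> ^ N * m"
  shows "0 < v n \<longleftrightarrow> n < (LEAST n. v n = 0)" and "(LEAST n. v n = 0) \<le> N"
proof -
  have "v N = 0"
  proof (rule ccontr)
    assume "v N \<noteq> 0"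
    then have "0 < v (0 + N)" using assms(1) unfolding weight_path_def by (metis add_0 atLeastAtMost_iff order_le_less)
    from weight_path_growth[OF assms(1,2) this] have "\<rho> ^ N * m \<le> v N" using assms(1) by (simp add: weight_path_def)
    moreover have "v N \<le> 1" using assms(1) unfolding weight_path_def by auto
    ultimately show False using assms(4) by simp
  qed
  then show "(LEAST n. v n = 0) \<le> N" by (rule Least_le)
  have z: "v (LEAST n. v n = 0) = 0" using \<open>v N = 0\<close> by (rule LeastI)
  have nonneg: "0 \<le> v n" using assms(1) unfolding weight_path_def by auto
  show "0 < v n \<longleftrightarrow> n < (LEAST n. v n = 0)"
  proof
    assume "0 < v n"
    show "n < (LEAST n. v n = 0)"
    proof (rule ccontr)
      assume "\<not> ?thesis"
      then obtain k where "n = (LEAST n. v n = 0) + k" using le_Suc_ex by (metis not_less)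
      with weight_path_growth[OF assms(1,2)] \<open>0 < v n\<close> z show False by force
    qed
  next
    assume "n < (LEAST n. v n = 0)"
    from not_less_Least[OF this] nonneg show "0 < v n" by simp
  qed
qed

section \<open>The joint law of the lengths\<close>

context hyperfractal_search
begin

lemma history_sets: "A \<in> sets (history M V I) \<Longrightarrow> A \<in> events"
  using subalgebra_history[of I V] weight_measurable by (auto simp: subalgebra_def)

lemma AE_weights_before: "AE \<omega> in M. 0 < V n \<omega> \<longrightarrow> (\<forall>i\<le>n. V i \<omega> \<in> {0<..1})"
  using AE_weight_path
proof eventually_elim
  case (elim \<omega>)
  have "V i \<omega> \<le> 1" for i using elim by (auto simp: weight_path_def)
  moreover have "0 < V i \<omega>" if "0 < V n \<omega>" "i \<le> n" for i
    using weight_path_growth[OF elim rho_gt_1, of i "n - i"] that by simp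
  ultimately show ?case by simp
qed

lemma nn_integral_lengths_rectangle:
  assumes A: "A \<in> sets (history M V UNIV)" and ex: "\<And>\<omega>. \<omega> \<in> A \<Longrightarrow> 0 < V n \<omega>"
    and B[measurable]: "\<And>i. B i \<in> sets borel"
  shows "(\<integral>\<^sup>+\<omega>. indicator A \<omega> * (\<Prod>i\<le>n. indicator (B i) (L i \<omega>)) \<partial>M)
    = (\<integral>\<^sup>+\<omega>. indicator A \<omega> * (\<Prod>i\<le>n. emeasure (length_law (V i \<omega>)) (B i)) \<partial>M)"
proof -
  note [measurable] = history_sets[OF A]
  let ?E = "{\<omega> \<in> space M. \<forall>i\<le>n. L i \<omega> \<in> B i}"
  have "(\<integral>\<^sup>+\<omega>. indicator A \<omega> * (\<Prod>i\<le>n. indicator (B i) (L i \<omega>)) \<partial>M)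
      = (\<integral>\<^sup>+\<omega>. indicator (A \<inter> ?E) \<omega> \<partial>M)"
    by (intro nn_integral_cong) (auto simp: indicator_def prod.neutral)
  also have "\<dots> = emeasure M (A \<inter> ?E)" by simp
  also have "\<dots> = (\<integral>\<^sup>+\<omega>. indicator A \<omega> * ennreal (\<Prod>i\<le>n. measure (\<Lambda> (V i \<omega>)) (B i)) \<partial>M)"
    by (rule nn_integral_conditional_probability[OF subalgebra_history _ A])
       (use lengths[of B n, OF B] ex in auto)
  also have "\<dots> = (\<integral>\<^sup>+\<omega>. indicator A \<omega> * (\<Prod>i\<le>n. emeasure (length_law (V i \<omega>)) (B i)) \<partial>M)"
    using AE_weights_before[of n]
  proof (intro nn_integral_cong_AE, eventually_elim)
    case (elim \<omega>)
    have "ennreal (measure (\<Lambda> (V i \<omega>)) (B i)) = emeasure (length_law (V i \<omega>)) (B i)" if "\<omega> \<in> A" "i \<le> n" for i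
    proof -
      have "V i \<omega> \<in> {0<..1}" using elim ex that by blast
      then have eq: "\<Lambda> (V i \<omega>) = length_law (V i \<omega>)" by (simp add: length_law_eq)
      show ?thesis
        unfolding eq finite_measure.emeasure_eq_measure[OF prob_space.finite_measure[OF prob_space_length_law]] ..
    qed
    then show ?case by (auto simp: indicator_def prod_ennreal[symmetric])
  qed
  finally show ?thesis .
qed

text \<open>
  Given the weights, the lengths are independent: the expectation of a product of functions, each of
  one weight and its length, factors conditionally on the weights. The factors are replaced one by
  one, from indicators of sets of lengths to general functions bounded by 1; the bound keeps the
  measures in the extension step finite.
\<close>

lemma nn_integral_lengths:
  fixes \<phi> :: "nat \<Rightarrow> real \<times> real \<Rightarrow> ennreal"
  assumes A: "A \<in> sets (history M V UNIV)" and ex: "\<And>\<omega>. \<omega> \<in> A \<Longrightarrow> 0 < V n \<omega>"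
    and \<phi>: "\<And>i. \<phi> i \<in> borel_measurable (borel \<Otimes>\<^sub>M borel)" "\<And>i z. \<phi> i z \<le> 1"
  shows "(\<integral>\<^sup>+\<omega>. indicator A \<omega> * (\<Prod>i\<le>n. \<phi> i (V i \<omega>, L i \<omega>)) \<partial>M)
    = (\<integral>\<^sup>+\<omega>. indicator A \<omega> * (\<Prod>i\<le>n. \<integral>\<^sup>+l. \<phi> i (V i \<omega>, l) \<partial>length_law (V i \<omega>)) \<partial>M)"
proof -
  have law[measurable]: "length_law \<in> borel \<rightarrow>\<^sub>M subprob_algebra borel"
    by (rule measurable_prob_algebraD[OF length_law_measurable])
  have "(\<integral>\<^sup>+\<omega>. indicator A \<omega> * (\<Prod>i\<le>n. \<phi> i (V i \<omega>, L i \<omega>)) \<partial>M)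
    = (\<integral>\<^sup>+\<omega>. indicator A \<omega> * (\<Prod>i\<le>n. \<integral>\<^sup>+l. \<phi> i (V i \<omega>, l) \<partial>length_law (V i \<omega>)) \<partial>M)"
    if "k \<le> Suc n" "A \<in> sets (history M V UNIV)" "\<And>\<omega>. \<omega> \<in> A \<Longrightarrow> 0 < V n \<omega>"
      "\<And>i. \<phi> i \<in> borel_measurable (borel \<Otimes>\<^sub>M borel)" "\<And>i z. \<phi> i z \<le> 1"
      \<comment> \<open>Only the factors below \<open>k\<close> are general.\<close>
      "\<And>i. k \<le> i \<Longrightarrow> i \<le> n \<Longrightarrow> \<exists>B \<in> sets borel. \<phi> i = (\<lambda>z. indicator B (snd z))"
    for k A and \<phi> :: "nat \<Rightarrow> real \<times> real \<Rightarrow> ennreal"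
    using that
  proof (induction k arbitrary: A \<phi>)
    case 0
    then have "\<forall>i. \<exists>B \<in> sets borel. i \<le> n \<longrightarrow> \<phi> i = (\<lambda>z. indicator B (snd z))" by blast
    then obtain B where B: "\<And>i. B i \<in> sets borel" "\<And>i. i \<le> n \<Longrightarrow> \<phi> i = (\<lambda>z. indicator (B i) (snd z))"
      by metis
    have *: "(\<integral>\<^sup>+l. indicator (B i) l \<partial>length_law u) = emeasure (length_law u) (B i)" for i u
      by (rule nn_integral_indicator) (simp add: B)
    show ?case using nn_integral_lengths_rectangle[OF 0(2,3) B(1)] by (simp add: B(2) *)
  next
    case (Suc k A \<phi>)
    note [measurable] = Suc.prems(4) history_sets[OF Suc.prems(2)]
    define \<Phi> where "\<Phi> = (\<lambda>i u. \<integral>\<^sup>+l. \<phi> i (u, l) \<partial>length_law u)"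
    have [measurable]: "\<Phi> i \<in> borel_measurable borel" for i
      unfolding \<Phi>_def by (rule nn_integral_measurable_subprob_algebra2[OF _ law]) measurable
    have kn: "k \<in> {..n}" using Suc.prems(1) by simp
    define w1 where "w1 = (\<lambda>\<omega>. indicator A \<omega> * (\<Prod>i\<in>{..n}-{k}. \<phi> i (V i \<omega>, L i \<omega>)))"
    define w2 where "w2 = (\<lambda>\<omega>. indicator A \<omega> * (\<Prod>i\<in>{..n}-{k}. \<Phi> i (V i \<omega>)))"
    have "(\<integral>\<^sup>+\<omega>. w1 \<omega> * \<phi> k (V k \<omega>, L k \<omega>) \<partial>M)
        = (\<integral>\<^sup>+\<omega>. w2 \<omega> * (\<integral>\<^sup>+l. \<phi> k (V k \<omega>, l) \<partial>length_law (V k \<omega>)) \<partial>M)"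
    proof (rule nn_integral_kernel_extension[OF _ _ _ _ length_law_measurable])
      show "w1 \<in> borel_measurable M" unfolding w1_def by measurable
      show "w2 \<in> borel_measurable M" unfolding w2_def by measurable
      have "w1 \<omega> \<le> 1" for \<omega>
      proof -
        have "(\<Prod>i\<in>{..n}-{k}. \<phi> i (V i \<omega>, L i \<omega>)) \<le> 1" by (rule prod_le_1) (simp add: Suc.prems(5))
        then show ?thesis by (simp add: w1_def indicator_def)
      qed
      then have "(\<integral>\<^sup>+\<omega>. w1 \<omega> \<partial>M) \<le> (\<integral>\<^sup>+\<omega>. 1 \<partial>M)" by (intro nn_integral_mono)
      then show "(\<integral>\<^sup>+\<omega>. w1 \<omega> \<partial>M) \<noteq> \<infinity>" by (auto simp: emeasure_space_1 top_unique)
      fix C B :: "real set" assume C[measurable]: "C \<in> sets borel" and B[measurable]: "B \<in> sets borel"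
      \<comment> \<open>A condition on the weight \<open>V k\<close> is absorbed into the event, which may be any event of the
        weight sequence; a condition on \<open>L k\<close> alone is covered by the induction hypothesis.\<close>
      define A' where "A' = A \<inter> {\<omega> \<in> space M. V k \<omega> \<in> C}"
      define \<phi>' where "\<phi>' = \<phi>(k := (\<lambda>z. indicator B (snd z)))"
      have A': "A' \<in> sets (history M V UNIV)"
        unfolding A'_def by (intro sets.Int Suc.prems(2) in_weight_history[where B = C and i = k]) auto
      have \<phi>'m: "\<phi>' i \<in> borel_measurable (borel \<Otimes>\<^sub>M borel)" for i
        unfolding \<phi>'_def by (cases "i = k") auto
      have \<phi>'_prod: "(\<Prod>i\<in>{..n}-{k}. g (\<phi>' i) i) = (\<Prod>i\<in>{..n}-{k}. g (\<phi> i) i)"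
        for g :: "_ \<Rightarrow> nat \<Rightarrow> ennreal"
        unfolding \<phi>'_def by (intro prod.cong) auto
      have IH: "(\<integral>\<^sup>+\<omega>. indicator A' \<omega> * (\<Prod>i\<le>n. \<phi>' i (V i \<omega>, L i \<omega>)) \<partial>M)
        = (\<integral>\<^sup>+\<omega>. indicator A' \<omega> * (\<Prod>i\<le>n. \<integral>\<^sup>+l. \<phi>' i (V i \<omega>, l) \<partial>length_law (V i \<omega>)) \<partial>M)"
      proof (rule Suc.IH[OF _ A' _ \<phi>'m])
        show "\<exists>B\<in>sets borel. \<phi>' i = (\<lambda>z. indicator B (snd z))" if "k \<le> i" "i \<le> n" for i
          using Suc.prems(6)[of i] that B by (cases "i = k") (auto simp: \<phi>'_def)
        show "\<phi>' i z \<le> 1" for i z using Suc.prems(5) by (simp add: \<phi>'_def indicator_def)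
      qed (use Suc.prems(1,3) in \<open>auto simp: A'_def\<close>)
      have "(\<integral>\<^sup>+\<omega>. w1 \<omega> * indicator C (V k \<omega>) * indicator B (L k \<omega>) \<partial>M)
          = (\<integral>\<^sup>+\<omega>. indicator A' \<omega> * (\<Prod>i\<le>n. \<phi>' i (V i \<omega>, L i \<omega>)) \<partial>M)"
      proof (intro nn_integral_cong)
        fix \<omega> assume "\<omega> \<in> space M"
        then show "w1 \<omega> * indicator C (V k \<omega>) * indicator B (L k \<omega>)
            = indicator A' \<omega> * (\<Prod>i\<le>n. \<phi>' i (V i \<omega>, L i \<omega>))"
          using \<phi>'_prod[of "\<lambda>h i. h (V i \<omega>, L i \<omega>)"]
          by (simp add: prod.remove[OF _ kn] w1_def A'_def) (simp add: \<phi>'_def indicator_def)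
      qed
      also have "\<dots> = (\<integral>\<^sup>+\<omega>. w2 \<omega> * indicator C (V k \<omega>) * emeasure (length_law (V k \<omega>)) B \<partial>M)"
        unfolding IH
      proof (intro nn_integral_cong)
        fix \<omega> assume "\<omega> \<in> space M"
        moreover have "(\<integral>\<^sup>+l. \<phi>' k (V k \<omega>, l) \<partial>length_law (V k \<omega>)) = emeasure (length_law (V k \<omega>)) B"
          by (simp add: \<phi>'_def)
        ultimately show "indicator A' \<omega> * (\<Prod>i\<le>n. \<integral>\<^sup>+l. \<phi>' i (V i \<omega>, l) \<partial>length_law (V i \<omega>))
            = w2 \<omega> * indicator C (V k \<omega>) * emeasure (length_law (V k \<omega>)) B"
          using \<phi>'_prod[of "\<lambda>h i. \<integral>\<^sup>+l. h (V i \<omega>, l) \<partial>length_law (V i \<omega>)"]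
          by (simp add: prod.remove[OF _ kn] w2_def A'_def \<Phi>_def) (simp add: indicator_def mult.commute)
      qed
      finally show "(\<integral>\<^sup>+\<omega>. w1 \<omega> * indicator C (V k \<omega>) * indicator B (L k \<omega>) \<partial>M)
          = (\<integral>\<^sup>+\<omega>. w2 \<omega> * indicator C (V k \<omega>) * emeasure (length_law (V k \<omega>)) B \<partial>M)" .
    qed measurable
    then show ?case by (simp add: prod.remove[OF _ kn] w1_def w2_def \<Phi>_def mult_ac)
  qed
  from this[of "Suc n" A \<phi>] show ?thesis using assms by auto
qed

lemma AE_length_nonneg: "AE \<omega> in M. 0 < V n \<omega> \<longrightarrow> 0 \<le> L n \<omega>"
proof -
  let ?A = "{\<omega> \<in> space M. V n \<omega> \<in> {0<..}}"
  let ?B = "\<lambda>i. if i = n then {..<0} else (UNIV :: real set)"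
  have A: "?A \<in> sets (history M V UNIV)" by (rule in_weight_history) auto
  have [measurable]: "?A \<in> events" by (rule history_sets[OF A])
  have [measurable]: "(\<lambda>\<omega>. indicator (?B i) (L i \<omega>) :: ennreal) \<in> borel_measurable M" for i
    by (cases "i = n") simp_all
  have null: "emeasure (length_law \<mu>) {..<0} = 0" if "\<mu> \<in> {0<..1}" for \<mu>
  proof -
    note law = length_law_eq[OF that]
    have "AE l in length_law \<mu>. \<not> l < 0" using length_nonneg[OF that] unfolding law by (simp add: not_less)
    moreover have "{l \<in> space (length_law \<mu>). \<not> \<not> l < 0} = {..<0}" by auto
    ultimately show ?thesis by (intro AE_iff_measurable[THEN iffD1]) auto
  qed
  have "(\<integral>\<^sup>+\<omega>. indicator ?A \<omega> * (\<Prod>i\<le>n. indicator (?B i) (L i \<omega>)) \<partial>M)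
    = (\<integral>\<^sup>+\<omega>. indicator ?A \<omega> * (\<Prod>i\<le>n. emeasure (length_law (V i \<omega>)) (?B i)) \<partial>M)"
    by (rule nn_integral_lengths_rectangle[OF A]) auto
  also have "\<dots> = 0"
  proof (rule nn_integral_zero', use AE_weights_before[of n] in eventually_elim)
    case (elim \<omega>)
    then show ?case using null[of "V n \<omega>"]
      by (auto simp: indicator_def intro!: bexI[of _ n])
  qed
  finally have "AE \<omega> in M. indicator ?A \<omega> * (\<Prod>i\<le>n. indicator (?B i) (L i \<omega>)) = (0 :: ennreal)"
    by (subst (asm) nn_integral_0_iff_AE) (measurable, simp)
  with AE_space show ?thesis
    by eventually_elim (auto simp: indicator_def split: if_splits)
qed

end

section \<open>Uniform estimates for one step\<close>

lemma nn_integral_powr_tail: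
  fixes a \<delta> :: real
  assumes "0 < a" "0 < \<delta>"
  shows "(\<integral>\<^sup>+\<nu>. ennreal (\<nu> powr (- \<delta> - 1)) * indicator {a..} \<nu> \<partial>lborel) = ennreal (a powr (- \<delta>) / \<delta>)"
proof -
  have "(\<integral>\<^sup>+\<nu>. ennreal (\<nu> powr (- \<delta> - 1)) * indicator {a..} \<nu> \<partial>lborel)
      = ennreal (0 - (- (a powr (- \<delta>) / \<delta>)))"
  proof (rule nn_integral_FTC_atLeast)
    show "((\<lambda>\<nu>. - (\<nu> powr (- \<delta>) / \<delta>)) has_real_derivative \<nu> powr (- \<delta> - 1)) (at \<nu>)" if "a \<le> \<nu>" for \<nu>
      using that assms by (auto intro!: derivative_eq_intros)
    have "((\<lambda>\<nu>. - (\<nu> powr (- \<delta>) / \<delta>)) \<longlongrightarrow> - (0 / \<delta>)) at_top"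
      using assms by (intro tendsto_intros tendsto_neg_powr filterlim_ident) auto
    then show "((\<lambda>\<nu>. - (\<nu> powr (- \<delta>) / \<delta>)) \<longlongrightarrow> 0) at_top" by simp
  qed auto
  then show ?thesis by simp
qed

context hyperfractal_model
begin

text \<open>
  A step from \<open>\<mu> \<le> u\<close> that exceeds the level \<open>u\<close> lands in \<open>{u<..2 * \<rho> * u}\<close> with conditional probability
  at least \<open>q\<close>, and \<open>q\<close> does not depend on \<open>\<mu>\<close> or \<open>u\<close>. Beyond the level the step has support
  \<open>{a<..}\<close> with \<open>a = max u (\<rho> * \<mu>)\<close>, and up to constants its density there is
  \<open>\<mu> powr \<delta> * \<nu> powr (- \<delta> - 1)\<close>; by scaling, a fixed proportion of the mass beyond \<open>a\<close> lies in
  \<open>{a<..2 * a}\<close>, and \<open>2 * a \<le> 2 * \<rho> * u\<close>. The complement of \<open>{0<..u}\<close> includes 0: leaving the street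
  system is also a crossing of \<open>u\<close>.
\<close>

lemma crossing_lands_in_window:
  obtains q where "0 < q"
    "\<And>\<mu> u. 0 < \<mu> \<Longrightarrow> \<mu> \<le> u \<Longrightarrow> 2 * \<rho> * u \<le> 1 \<Longrightarrow>
       ennreal q * emeasure (next_weight_law p \<mu>) (- {0<..u}) \<le> emeasure (next_weight_law p \<mu>) {u<..2 * \<rho> * u}"
proof -
  from density_theta obtain c C where "0 < c" "0 < C" and theta:
    "\<And>\<mu> \<nu>. \<mu> \<in> {0<..1} \<Longrightarrow> \<rho> * \<mu> < \<nu> \<Longrightarrow>
       c * ((\<nu> / \<mu>) powr (- \<delta>) * (1 / \<nu>)) \<le> p \<nu> \<mu> \<and> p \<nu> \<mu> \<le> C * ((\<nu> / \<mu>) powr (- \<delta>) * (1 / \<nu>))"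
    unfolding unif_theta_def by fastforce
  \<comment> \<open>The power law is at least its value at \<open>2 * a\<close> on \<open>{a<..2 * a}\<close>; the tail integral is \<open>a powr (- \<delta>) / \<delta>\<close>.\<close>
  define q where "q = c * \<delta> * 2 powr (- \<delta> - 1) / C"
  have "0 < q" using \<open>0 < c\<close> \<open>0 < C\<close> delta_pos by (simp add: q_def)
  moreover have "ennreal q * emeasure (next_weight_law p \<mu>) (- {0<..u}) \<le> emeasure (next_weight_law p \<mu>) {u<..2 * \<rho> * u}"
    if \<mu>0: "0 < \<mu>" and \<mu>u: "\<mu> \<le> u" and u1: "2 * \<rho> * u \<le> 1" for \<mu> u
  proof -
    define a where "a = max u (\<rho> * \<mu>)"
    have scale: "2 * (\<rho> * u) \<le> 1" "u \<le> \<rho> * u" "\<mu> \<le> \<rho> * \<mu>" "0 < \<rho> * \<mu>" "\<rho> * \<mu> \<le> \<rho> * u"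
      using \<mu>0 \<mu>u u1 rho_gt_1 by (auto simp: mult.assoc)
    then have \<mu>: "\<mu> \<in> {0<..1}" using \<mu>0 \<mu>u unfolding greaterThanAtMost_iff by linarith
    have a: "0 < a" "u \<le> a" "\<rho> * \<mu> \<le> a" "2 * a \<le> 2 * \<rho> * u" "2 * a \<le> 1"
      unfolding a_def mult.assoc using scale \<mu>0 \<mu>u by linarith+
    have shape: "(\<nu> / \<mu>) powr (- \<delta>) * (1 / \<nu>) = \<mu> powr \<delta> * \<nu> powr (- \<delta> - 1)" if "0 < \<nu>" for \<nu>
      using that \<mu>0 by (simp add: powr_divide powr_minus powr_diff divide_simps)
    note [measurable] = density_measurable_section[OF \<mu>]
    have "emeasure (next_weight_law p \<mu>) (- {0<..u})
        \<le> (\<integral>\<^sup>+\<nu>. ennreal (C * \<mu> powr \<delta>) * (ennreal (\<nu> powr (- \<delta> - 1)) * indicator {a..} \<nu>) \<partial>lborel)"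
      unfolding emeasure_next_weight_law[OF \<mu> borel_comp[OF greaterThanAtMost_borel]]
    proof (rule nn_integral_mono)
      fix \<nu>
      show "ennreal (p \<nu> \<mu>) * indicator (- {0<..u}) (if \<nu> \<le> 1 then \<nu> else 0)
        \<le> ennreal (C * \<mu> powr \<delta>) * (ennreal (\<nu> powr (- \<delta> - 1)) * indicator {a..} \<nu>)"
      proof (cases "\<rho> * \<mu> < \<nu> \<and> u < \<nu>")
        case True
        then have "0 < \<nu>" "a \<le> \<nu>" using a by (auto simp: a_def)
        then have "p \<nu> \<mu> \<le> C * \<mu> powr \<delta> * \<nu> powr (- \<delta> - 1)"
          using theta[OF \<mu>, of \<nu>] True unfolding shape[OF \<open>0 < \<nu>\<close>] by (simp add: mult.assoc)
        then show ?thesis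
          using \<open>a \<le> \<nu>\<close> \<open>0 < C\<close> by (auto simp: indicator_def ennreal_mult[symmetric] intro!: ennreal_leI)
      next
        case False
        then have "ennreal (p \<nu> \<mu>) * indicator (- {0<..u}) (if \<nu> \<le> 1 then \<nu> else 0) = 0"
          using density_zero[OF \<mu>, of \<nu>] scale a by (cases "\<nu> \<le> \<rho> * \<mu>") (auto simp: indicator_def)
        then show ?thesis by (simp only: zero_le)
      qed
    qed
    also have "\<dots> = ennreal (C * \<mu> powr \<delta>) * ennreal (a powr (- \<delta>) / \<delta>)"
      by (subst nn_integral_cmult) (auto simp: nn_integral_powr_tail a delta_pos)
    finally have "ennreal q * emeasure (next_weight_law p \<mu>) (- {0<..u})
        \<le> ennreal q * (ennreal (C * \<mu> powr \<delta>) * ennreal (a powr (- \<delta>) / \<delta>))" by (rule mult_left_mono) simp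
    also have "\<dots> = ennreal (q * (C * \<mu> powr \<delta> * (a powr (- \<delta>) / \<delta>)))"
      using \<open>0 < q\<close> \<open>0 < C\<close> delta_pos by (simp add: ennreal_mult[symmetric])
    also have "q * (C * \<mu> powr \<delta> * (a powr (- \<delta>) / \<delta>)) = c * \<mu> powr \<delta> * (2 * a) powr (- \<delta> - 1) * a"
      using \<open>0 < C\<close> delta_pos a by (simp add: q_def powr_mult powr_diff divide_simps)
    also have "ennreal \<dots> = (\<integral>\<^sup>+\<nu>. ennreal (c * \<mu> powr \<delta> * (2 * a) powr (- \<delta> - 1)) * indicator {a<..2 * a} \<nu> \<partial>lborel)"
      using a \<open>0 < c\<close> by (subst nn_integral_cmult_indicator) (auto simp: ennreal_mult[symmetric])
    also have "\<dots> \<le> (\<integral>\<^sup>+\<nu>. ennreal (p \<nu> \<mu>) * indicator {u<..2 * \<rho> * u} (if \<nu> \<le> 1 then \<nu> else 0) \<partial>lborel)"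
    proof (rule nn_integral_mono)
      fix \<nu>
      show "ennreal (c * \<mu> powr \<delta> * (2 * a) powr (- \<delta> - 1)) * indicator {a<..2 * a} \<nu>
         \<le> ennreal (p \<nu> \<mu>) * indicator {u<..2 * \<rho> * u} (if \<nu> \<le> 1 then \<nu> else 0)"
      proof (cases "a < \<nu> \<and> \<nu> \<le> 2 * a")
        case True
        then have "c * \<mu> powr \<delta> * (2 * a) powr (- \<delta> - 1) \<le> c * \<mu> powr \<delta> * \<nu> powr (- \<delta> - 1)"
          using \<open>0 < c\<close> a delta_pos by (intro mult_left_mono powr_mono2') auto
        also have "\<dots> \<le> p \<nu> \<mu>"
          using theta[OF \<mu>, of \<nu>] True a shape[of \<nu>] by (simp add: mult.assoc del: times_divide_eq_right)
        finally show ?thesis using True a by (auto simp: indicator_def intro!: ennreal_leI)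
      qed simp
    qed
    also have "\<dots> = emeasure (next_weight_law p \<mu>) {u<..2 * \<rho> * u}"
      by (rule emeasure_next_weight_law[OF \<mu>, symmetric]) simp
    finally show ?thesis .
  qed
  ultimately show thesis by (rule that)
qed

text \<open>
  A Bochner integral that is positive belongs to an integrable function, so the lower bound on the
  mean length gives integrability.
\<close>

lemma length_integrable:
  assumes x: "0 < x" and \<mu>: "\<mu> \<in> {0<..1}"
  shows "integrable (\<Lambda> \<mu>) (\<lambda>l. x * \<mu> * l)"
proof -
  from length_mean obtain c where "0 < c"
    and c: "\<And>x \<mu>. 0 < x \<Longrightarrow> \<mu> \<in> {0<..1} \<Longrightarrow> c * (x * \<mu> powr (\<delta> + 1)) \<le> (\<integral>l. x * \<mu> * l \<partial>\<Lambda> \<mu>)"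
    unfolding unif_theta_def by fastforce
  have "0 < c * (x * \<mu> powr (\<delta> + 1))" using \<open>0 < c\<close> x \<mu> by simp
  also note c[OF x \<mu>]
  finally show ?thesis by (auto dest: not_integrable_integral_eq)
qed

text \<open>
  Jensen's inequality for \<open>exp (- y)\<close>: the probability of driving past a segment without parking is at
  least the exponential of minus the mean number of free slots. The absolute value changes nothing
  almost surely, and it makes the integrand bounded by 1 everywhere.
\<close>

lemma not_parking_probability_ge:
  obtains C where "0 < C"
    "\<And>x \<mu>. 0 < x \<Longrightarrow> \<mu> \<in> {0<..1} \<Longrightarrow>
       ennreal (exp (- (C * (x * \<mu> powr (\<delta> + 1))))) \<le> (\<integral>\<^sup>+l. ennreal (exp (- \<bar>x * \<mu> * l\<bar>)) \<partial>length_law \<mu>)"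
proof -
  from length_mean obtain C where "0 < C"
    and C: "\<And>x \<mu>. 0 < x \<Longrightarrow> \<mu> \<in> {0<..1} \<Longrightarrow> (\<integral>l. x * \<mu> * l \<partial>\<Lambda> \<mu>) \<le> C * (x * \<mu> powr (\<delta> + 1))"
    unfolding unif_theta_def by fastforce
  have "ennreal (exp (- (C * (x * \<mu> powr (\<delta> + 1))))) \<le> (\<integral>\<^sup>+l. ennreal (exp (- \<bar>x * \<mu> * l\<bar>)) \<partial>length_law \<mu>)"
    if x: "0 < x" and \<mu>: "\<mu> \<in> {0<..1}" for x \<mu>
  proof -
    interpret N: prob_space "\<Lambda> \<mu>" using prob_space_length_law[of \<mu>] length_law_eq[OF \<mu>] by simp
    have sets[measurable_cong]: "sets (\<Lambda> \<mu>) = sets borel" using sets_length_law[of \<mu>] length_law_eq[OF \<mu>] by simp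
    note int = length_integrable[OF x \<mu>]
    \<comment> \<open>The tangent of the exponential at the mean gives the inequality.\<close>
    define a where "a = (\<integral>l. x * \<mu> * l \<partial>\<Lambda> \<mu>)"
    have "exp (- (C * (x * \<mu> powr (\<delta> + 1)))) \<le> exp (- a)" using C[OF x \<mu>] by (simp add: a_def)
    also have "\<dots> = (\<integral>l. exp (- a) * (1 + a - x * \<mu> * l) \<partial>\<Lambda> \<mu>)"
      using int by (simp add: N.prob_space a_def)
    also have "\<dots> \<le> (\<integral>l. exp (- \<bar>x * \<mu> * l\<bar>) \<partial>\<Lambda> \<mu>)"
    proof (rule integral_mono_AE)
      show "integrable (\<Lambda> \<mu>) (\<lambda>l. exp (- a) * (1 + a - x * \<mu> * l))" using int by simp
      show "integrable (\<Lambda> \<mu>) (\<lambda>l. exp (- \<bar>x * \<mu> * l\<bar>))"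
        by (rule N.integrable_const_bound[where B = 1]) auto
      show "AE l in \<Lambda> \<mu>. exp (- a) * (1 + a - x * \<mu> * l) \<le> exp (- \<bar>x * \<mu> * l\<bar>)"
        using length_nonneg[OF \<mu>]
      proof eventually_elim
        case (elim l)
        have "exp (- a) * (1 + (a - x * \<mu> * l)) \<le> exp (- a) * exp (a - x * \<mu> * l)"
          by (intro mult_left_mono exp_ge_add_one_self) simp
        then show ?case using elim x \<mu> by (simp add: exp_add[symmetric] add_diff_eq)
      qed
    qed
    also have "ennreal \<dots> = (\<integral>\<^sup>+l. ennreal (exp (- \<bar>x * \<mu> * l\<bar>)) \<partial>length_law \<mu>)"
      unfolding length_law_eq[OF \<mu>]
      by (rule nn_integral_eq_integral[symmetric], rule N.integrable_const_bound[where B = 1]) auto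
    finally show ?thesis by (auto intro: ennreal_leI)
  qed
  with \<open>0 < C\<close> show thesis by (rule that)
qed

text \<open>
  The function \<open>\<eta>\<close> is known only through the parking probabilities, but its comparison with them holds
  at every weight. On streets of weight 1 the parking probability is nondecreasing in \<open>x\<close>, and it is
  positive at \<open>x = 1\<close> since the lengths have positive mean. Hence \<open>\<eta>\<close> is bounded away from 0 on
  \<open>{1..}\<close>, and so are the parking probabilities at every other weight with
  \<open>1 \<le> x * \<mu> powr (\<delta> + 1)\<close>.
\<close>

lemma parking_probability_ge:
  obtains \<kappa> where "0 < \<kappa>"
    "\<And>x \<mu>. 0 < x \<Longrightarrow> \<mu> \<in> {0<..1} \<Longrightarrow> 1 \<le> x * \<mu> powr (\<delta> + 1) \<Longrightarrow>
       ennreal \<kappa> \<le> (\<integral>\<^sup>+l. ennreal (1 - exp (- \<bar>x * \<mu> * l\<bar>)) \<partial>length_law \<mu>)"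
proof -
  from length_parking obtain c C where "0 < c" "0 < C" and theta:
    "\<And>x \<mu>. 0 < x \<Longrightarrow> \<mu> \<in> {0<..1} \<Longrightarrow>
       c * \<eta> (x * \<mu> powr (\<delta> + 1)) \<le> (\<integral>l. 1 - exp (- (x * \<mu> * l)) \<partial>\<Lambda> \<mu>)
       \<and> (\<integral>l. 1 - exp (- (x * \<mu> * l)) \<partial>\<Lambda> \<mu>) \<le> C * \<eta> (x * \<mu> powr (\<delta> + 1))"
    unfolding unif_theta_def by fastforce
  have prob: "prob_space (\<Lambda> \<mu>)" if "\<mu> \<in> {0<..1}" for \<mu>
    using prob_space_length_law[of \<mu>] length_law_eq[OF that] by simp
  have sets: "sets (\<Lambda> \<mu>) = sets borel" if "\<mu> \<in> {0<..1}" for \<mu>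
    using sets_length_law[of \<mu>] length_law_eq[OF that] by simp
  have int: "integrable (\<Lambda> \<mu>) (\<lambda>l. 1 - exp (- (x * \<mu> * l)))" if x: "0 < x" and \<mu>: "\<mu> \<in> {0<..1}" for x \<mu>
  proof -
    interpret prob_space "\<Lambda> \<mu>" by (rule prob[OF \<mu>])
    note [measurable_cong] = sets[OF \<mu>]
    show ?thesis
    proof (rule integrable_const_bound[where B = 1])
      show "AE l in \<Lambda> \<mu>. norm (1 - exp (- (x * \<mu> * l))) \<le> 1"
        using length_nonneg[OF \<mu>] by eventually_elim (use x \<mu> in auto)
    qed measurable
  qed
  define g where "g = (\<integral>l. 1 - exp (- l) \<partial>\<Lambda> 1)"
  have one: "(1 :: real) \<in> {0<..1}" by simp
  have "0 < g"
  proof -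
    have "0 \<le> g" unfolding g_def
      by (rule integral_nonneg_AE, use length_nonneg[OF one] in eventually_elim) auto
    moreover have "g \<noteq> 0"
    proof
      assume "g = 0"
      then have "AE l in \<Lambda> 1. 1 - exp (- l) = 0"
        unfolding g_def using int[of 1 1] length_nonneg[OF one]
        by (subst (asm) integral_nonneg_eq_0_iff_AE) auto
      then have "AE l in \<Lambda> 1. 1 * 1 * l = 0" by eventually_elim simp
      then have "(\<integral>l. 1 * 1 * l \<partial>\<Lambda> 1) = 0" by (simp add: integral_eq_zero_AE)
      moreover from length_mean obtain c where "0 < c"
        and c: "\<And>x \<mu>. 0 < x \<Longrightarrow> \<mu> \<in> {0<..1} \<Longrightarrow> c * (x * \<mu> powr (\<delta> + 1)) \<le> (\<integral>l. x * \<mu> * l \<partial>\<Lambda> \<mu>)"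
        unfolding unif_theta_def by fastforce
      ultimately show False using c[of 1 1] by simp
    qed
    ultimately show ?thesis by simp
  qed
  define \<kappa> where "\<kappa> = c * (g / C)"
  have "0 < \<kappa>" using \<open>0 < g\<close> \<open>0 < c\<close> \<open>0 < C\<close> by (simp add: \<kappa>_def)
  moreover have "ennreal \<kappa> \<le> (\<integral>\<^sup>+l. ennreal (1 - exp (- \<bar>x * \<mu> * l\<bar>)) \<partial>length_law \<mu>)"
    if x: "0 < x" and \<mu>: "\<mu> \<in> {0<..1}" and s: "1 \<le> x * \<mu> powr (\<delta> + 1)" for x \<mu>
  proof -
    define s where "s = x * \<mu> powr (\<delta> + 1)"
    have "g \<le> (\<integral>l. 1 - exp (- (s * 1 * l)) \<partial>\<Lambda> 1)"
      unfolding g_def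
    proof (rule integral_mono_AE)
      show "AE l in \<Lambda> 1. 1 - exp (- l) \<le> 1 - exp (- (s * 1 * l))"
        using length_nonneg[OF one]
      proof eventually_elim
        case (elim l)
        then have "1 * l \<le> s * l" using s unfolding s_def by (intro mult_right_mono) auto
        then show ?case by simp
      qed
    qed (use int[of 1 1] int[of s 1] s in \<open>auto simp: s_def\<close>)
    also have "\<dots> \<le> C * \<eta> s" using theta[of s 1] s by (simp add: s_def)
    finally have "g / C \<le> \<eta> s" using \<open>0 < C\<close> by (simp add: divide_simps mult.commute)
    then have "\<kappa> \<le> c * \<eta> s" unfolding \<kappa>_def using \<open>0 < c\<close> by (intro mult_left_mono) auto
    also have "\<dots> \<le> (\<integral>l. 1 - exp (- (x * \<mu> * l)) \<partial>\<Lambda> \<mu>)" using theta[OF x \<mu>] by (simp add: s_def)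
    also have "ennreal \<dots> = (\<integral>\<^sup>+l. ennreal (1 - exp (- (x * \<mu> * l))) \<partial>\<Lambda> \<mu>)"
      by (rule nn_integral_eq_integral[symmetric, OF int[OF x \<mu>]], use length_nonneg[OF \<mu>] in eventually_elim)
         (use x \<mu> in auto)
    also have "\<dots> = (\<integral>\<^sup>+l. ennreal (1 - exp (- \<bar>x * \<mu> * l\<bar>)) \<partial>length_law \<mu>)"
      unfolding length_law_eq[OF \<mu>]
      by (rule nn_integral_cong_AE, use length_nonneg[OF \<mu>] in eventually_elim) (use x \<mu> in auto)
    finally show ?thesis by (auto intro: ennreal_leI)
  qed
  ultimately show thesis by (rule that)
qed

end

section \<open>The driven distance in the order of travel\<close>

text \<open>
  The summand of \<open>driven_distance\<close>, re-indexed by the order of travel: this is the order in which the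
  chain is given, and a summand then involves only the present segment and the past.
\<close>

definition travel_term :: "real \<Rightarrow> (nat \<Rightarrow> real) \<Rightarrow> (nat \<Rightarrow> real) \<Rightarrow> nat \<Rightarrow> real" where
  "travel_term x v l n =
     (1 - exp (- (x * v n) * l n)) / (x * v n) * (\<Prod>j<n. exp (- (x * v j) * l j))"

lemma driven_distance_travel_order:
  "driven_distance x k (\<lambda>i. v (k - i)) (\<lambda>i. l (k - i)) = (\<Sum>n<k. travel_term x v l n)"
proof -
  have "(\<Prod>j = i + 1..k. exp (- (x * v (k - j)) * l (k - j))) = (\<Prod>j<k - i. exp (- (x * v j) * l j))" for i
    by (rule prod.reindex_bij_witness[where i = "\<lambda>j. k - j" and j = "\<lambda>j. k - j"]) auto
  then show ?thesis
    unfolding driven_distance_def travel_term_def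
    by (intro sum.reindex_bij_witness[where i = "\<lambda>j. k - j" and j = "\<lambda>j. k - j"]) auto
qed

lemma path_distance_eq:
  "path_distance x V L \<omega> = (\<Sum>n<num_segments V \<omega>. travel_term x (\<lambda>i. V i \<omega>) (\<lambda>i. L i \<omega>) n)"
  unfolding path_distance_def
  using driven_distance_travel_order[of x _ "\<lambda>i. V i \<omega>" "\<lambda>i. L i \<omega>"] by simp

lemma travel_term_bounds:
  assumes "0 < x" "0 < m" "\<And>i. i \<le> n \<Longrightarrow> m \<le> v i" "\<And>i. i \<le> n \<Longrightarrow> 0 \<le> l i"
  shows "0 \<le> travel_term x v l n" "travel_term x v l n \<le> 1 / (x * m)"
proof -
  have pos: "0 < v i" if "i \<le> n" for i using assms(2) assms(3)[OF that] by simp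
  have "0 \<le> x * v i * l i" if "i \<le> n" for i using pos[OF that] assms(1) assms(4)[OF that] by simp
  then have e: "0 \<le> (\<Prod>j<n. exp (- (x * v j) * l j))" "(\<Prod>j<n. exp (- (x * v j) * l j)) \<le> 1"
    "0 \<le> 1 - exp (- (x * v n) * l n)" "1 - exp (- (x * v n) * l n) \<le> 1"
    by (auto intro!: prod_nonneg prod_le_1)
  have xv: "0 < x * v n" "x * m \<le> x * v n" "0 < x * m" using pos assms by auto
  show "0 \<le> travel_term x v l n"
    unfolding travel_term_def using e xv by (intro mult_nonneg_nonneg divide_nonneg_pos) auto
  have "travel_term x v l n \<le> (1 / (x * m)) * 1"
    unfolding travel_term_def by (intro mult_mono frac_le e xv divide_nonneg_pos) (use xv in auto)
  then show "travel_term x v l n \<le> 1 / (x * m)" by simp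
qed

context hyperfractal_search
begin

lemma path_distance_measurable: "(\<lambda>\<omega>. path_distance x V L \<omega>) \<in> borel_measurable M"
  unfolding path_distance_eq num_segments_def travel_term_def
  by (rule measurable_compose_countable[where g = "\<lambda>\<omega>. LEAST n. V n \<omega> = 0"]) measurable

lemma bounded_segments:
  obtains N where "1 < \<rho> ^ N * m"
proof -
  obtain N where "1 / m < \<rho> ^ N" using real_arch_pow[OF rho_gt_1] by auto
  with that[of N] start_in show thesis by (simp add: divide_simps mult.commute)
qed

lemma AE_existing_segments:
  "AE \<omega> in M. weight_path \<rho> m (\<lambda>n. V n \<omega>) \<and> (\<forall>n. 0 < V n \<omega> \<longrightarrow> (\<forall>i\<le>n. m \<le> V i \<omega> \<and> 0 \<le> L i \<omega>))"
proof -
  have "AE \<omega> in M. \<forall>n. 0 < V n \<omega> \<longrightarrow> 0 \<le> L n \<omega>" using AE_length_nonneg by (simp add: AE_all_countable)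
  with AE_weight_path show ?thesis
  proof eventually_elim
    case (elim \<omega>)
    have "m \<le> V i \<omega> \<and> 0 \<le> L i \<omega>" if "0 < V n \<omega>" "i \<le> n" for n i
    proof -
      have pos: "0 < V i \<omega>" using weight_path_growth[OF elim(1) rho_gt_1, of i "n - i"] that by simp
      have "\<rho> ^ i * m \<le> V i \<omega>"
        using weight_path_growth[OF elim(1) rho_gt_1, of 0 i] pos elim(1) by (simp add: weight_path_def)
      moreover have "1 * m \<le> \<rho> ^ i * m" using rho_gt_1 start_in by (intro mult_right_mono) auto
      ultimately show ?thesis using pos elim(2) by auto
    qed
    with elim show ?case by blast
  qed
qed

text \<open>
  Each term is at most \<open>1 / (x * m)\<close> and the number of terms is bounded, so the driven distance is
  bounded almost surely. Integrability matters because the Bochner integral of a non-integrable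
  function is 0 by convention, which would spoil every lower bound.
\<close>

lemma path_distance_integrable:
  assumes x: "0 < x"
  shows "integrable M (\<lambda>\<omega>. path_distance x V L \<omega>)" "AE \<omega> in M. 0 \<le> path_distance x V L \<omega>"
proof -
  obtain N where N: "1 < \<rho> ^ N * m" by (rule bounded_segments)
  have "AE \<omega> in M. 0 \<le> path_distance x V L \<omega> \<and> path_distance x V L \<omega> \<le> N * (1 / (x * m))"
    using AE_existing_segments
  proof eventually_elim
    case (elim \<omega>)
    note num = weight_path_positive_iff[OF _ rho_gt_1 _ N, of "\<lambda>n. V n \<omega>", folded num_segments_def]
    have m: "0 < m" using start_in by simp
    have t: "0 \<le> travel_term x (\<lambda>i. V i \<omega>) (\<lambda>i. L i \<omega>) n \<and> travel_term x (\<lambda>i. V i \<omega>) (\<lambda>i. L i \<omega>) n \<le> 1 / (x * m)"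
      if "n < num_segments V \<omega>" for n
    proof -
      have "0 < V n \<omega>" using num(1)[of n] elim m that by simp
      with elim have "\<And>i. i \<le> n \<Longrightarrow> m \<le> V i \<omega>" "\<And>i. i \<le> n \<Longrightarrow> 0 \<le> L i \<omega>" by blast+
      from travel_term_bounds[OF x m this] show ?thesis by simp
    qed
    have "path_distance x V L \<omega> \<le> of_nat (card {..<num_segments V \<omega>}) * (1 / (x * m))"
      unfolding path_distance_eq using t by (intro sum_bounded_above) auto
    also have "\<dots> \<le> N * (1 / (x * m))" using num(2) elim m x by (intro mult_right_mono) auto
    finally show ?case unfolding path_distance_eq using t by (auto intro!: sum_nonneg)
  qed
  then show "integrable M (\<lambda>\<omega>. path_distance x V L \<omega>)" "AE \<omega> in M. 0 \<le> path_distance x V L \<omega>"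
    using path_distance_measurable by (auto intro!: integrable_const_bound[where B = "N * (1 / (x * m))"])
qed

section \<open>Crossing a level\<close>

definition crossing :: "real \<Rightarrow> nat \<Rightarrow> 'a set" where
  "crossing u n = {\<omega> \<in> space M. V n \<omega> \<in> {0<..u}} \<inter> {\<omega> \<in> space M. V (Suc n) \<omega> \<in> - {0<..u}}"

definition crossing_into_window :: "real \<Rightarrow> nat \<Rightarrow> 'a set" where
  "crossing_into_window u n =
     {\<omega> \<in> space M. V n \<omega> \<in> {0<..u}} \<inter> {\<omega> \<in> space M. V (Suc n) \<omega> \<in> {u<..2 * \<rho> * u}}"

text \<open>
  The chain starts below the level and ends, so almost surely some step leaves \<open>{0<..u}\<close>.
\<close>

lemma sum_crossing_ge_1:
  assumes "m \<le> u" and N: "1 < \<rho> ^ N * m"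
  shows "1 \<le> (\<Sum>n<N. emeasure M (crossing u n))"
proof -
  have [measurable]: "crossing u n \<in> events" for n unfolding crossing_def by measurable
  have "AE \<omega> in M. \<omega> \<in> (\<Union>n<N. crossing u n)"
    using AE_weight_path AE_space
  proof eventually_elim
    case (elim \<omega>)
    have 0: "V 0 \<omega> \<in> {0<..u}" using elim assms start_in by (simp add: weight_path_def)
    have "\<not> 0 < V N \<omega>"
      using weight_path_positive_iff[OF elim(1) rho_gt_1 _ N] start_in by (auto simp: not_less)
    then have "V N \<omega> \<notin> {0<..u}" by simp
    then obtain k where "\<forall>i<k. \<not> V i \<omega> \<notin> {0<..u}" "V k \<omega> \<notin> {0<..u}" "k \<le> N"
      using ex_least_nat_le[of "\<lambda>k. V k \<omega> \<notin> {0<..u}" N] by blast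
    then show ?case using 0 elim(2) by (cases k) (auto simp: crossing_def)
  qed
  then have "emeasure M (\<Union>n<N. crossing u n) = 1" by (intro emeasure_eq_1_AE) auto
  moreover have "emeasure M (\<Union>n<N. crossing u n) \<le> (\<Sum>n<N. emeasure M (crossing u n))"
    by (rule emeasure_subadditive_finite) auto
  ultimately show ?thesis by simp
qed

lemma crossing_into_window_ge:
  assumes u: "2 * \<rho> * u \<le> 1"
    and q: "\<And>\<mu> u. 0 < \<mu> \<Longrightarrow> \<mu> \<le> u \<Longrightarrow> 2 * \<rho> * u \<le> 1 \<Longrightarrow>
       ennreal q * emeasure (next_weight_law p \<mu>) (- {0<..u}) \<le> emeasure (next_weight_law p \<mu>) {u<..2 * \<rho> * u}"
  shows "ennreal q * emeasure M (crossing u n) \<le> emeasure M (crossing_into_window u n)"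
proof -
  let ?A = "{\<omega> \<in> space M. V n \<omega> \<in> {0<..u}}"
  have A: "?A \<in> sets (history M V {..n})"
    by (rule in_weight_history[where B = "{0<..u}" and i = n]) auto
  have "?A \<in> events" by (rule history_sets[OF A])
  \<comment> \<open>Pulling out the constant needs a measurable integrand, hence the passage to the conditional
    expectation \<open>?R\<close>.\<close>
  let ?K = "\<lambda>\<omega>. measure (next_weight_law p (V n \<omega>)) (- {0<..u})"
  let ?R = "real_cond_exp M (history M V {..n}) (indicator {\<omega> \<in> space M. V (Suc n) \<omega> \<in> - {0<..u}})"
  have RK: "AE \<omega> in M. ?R \<omega> = ?K \<omega>" by (rule markov) simp
  have "ennreal q * emeasure M (crossing u n) = ennreal q * (\<integral>\<^sup>+\<omega>. indicator ?A \<omega> * ennreal (?K \<omega>) \<partial>M)"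
    unfolding crossing_def by (subst emeasure_next_weight[OF A]) auto
  also have "(\<integral>\<^sup>+\<omega>. indicator ?A \<omega> * ennreal (?K \<omega>) \<partial>M) = (\<integral>\<^sup>+\<omega>. indicator ?A \<omega> * ennreal (?R \<omega>) \<partial>M)"
    by (rule nn_integral_cong_AE, use RK in eventually_elim) simp
  also have "ennreal q * \<dots> = (\<integral>\<^sup>+\<omega>. ennreal q * (indicator ?A \<omega> * ennreal (?R \<omega>)) \<partial>M)"
    by (intro nn_integral_cmult[symmetric] borel_measurable_times_ennreal borel_measurable_indicator \<open>?A \<in> events\<close>
      measurable_compose[OF borel_measurable_cond_exp2 measurable_ennreal])
  also have "\<dots> = (\<integral>\<^sup>+\<omega>. ennreal q * (indicator ?A \<omega> * ennreal (?K \<omega>)) \<partial>M)"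
    by (rule nn_integral_cong_AE, use RK in eventually_elim) simp
  also have "\<dots> \<le> (\<integral>\<^sup>+\<omega>. indicator ?A \<omega> * ennreal (measure (next_weight_law p (V n \<omega>)) {u<..2 * \<rho> * u}) \<partial>M)"
    using AE_weight_range[of n]
  proof (intro nn_integral_mono_AE, eventually_elim)
    case (elim \<omega>)
    show ?case
    proof (cases "V n \<omega> \<in> {0<..u}")
      case True
      then have V: "V n \<omega> \<in> {0<..1}" using elim by auto
      note em = finite_measure.emeasure_eq_measure[OF prob_space.finite_measure[OF prob_space_next_weight_law[OF V]]]
      show ?thesis using q[of "V n \<omega>" u] True u by (auto simp: indicator_def em)
    qed (auto simp: indicator_def)
  qed
  also have "\<dots> = emeasure M (crossing_into_window u n)"
    unfolding crossing_into_window_def by (subst emeasure_next_weight[OF A]) auto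
  finally show ?thesis .
qed

end

section \<open>Lower bound for the expected distance\<close>

lemma sum_geometric_le:
  fixes r :: real
  assumes "0 \<le> r" "r < 1"
  shows "(\<Sum>j\<le>n. r ^ (n - j)) \<le> 1 / (1 - r)"
proof -
  have "(\<Sum>j\<le>n. r ^ (n - j)) = (\<Sum>k\<le>n. r ^ k)"
    by (rule sum.reindex_bij_witness[where i = "\<lambda>j. n - j" and j = "\<lambda>j. n - j"]) auto
  also have "\<dots> \<le> 1 / (1 - r)" using assms by (simp add: sum_gp0 divide_right_mono)
  finally show ?thesis .
qed

text \<open>
  Going backwards from the last weight below the critical level, the weights decay at least
  geometrically, so the mean numbers of free slots on all segments driven so far have a bounded sum,
  however small the starting weight is.
\<close>

lemma weight_path_energy_le:
  assumes v: "weight_path \<rho> m v" and rho: "1 < \<rho>" and "0 < \<delta>" "0 < x"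
    and n: "0 < v n" "v n \<le> u" and u: "x * u powr (\<delta> + 1) = 1"
  shows "(\<Sum>j\<le>n. x * v j powr (\<delta> + 1)) \<le> 1 / (1 - 1 / \<rho>)"
proof -
  have "x * v j powr (\<delta> + 1) \<le> (1 / \<rho>) ^ (n - j)" if "j \<le> n" for j
  proof -
    let ?r = "(1 / \<rho>) ^ (n - j)"
    have r: "0 \<le> ?r" "?r \<le> 1" using rho by (auto simp: power_le_one)
    have "0 < v j" "\<rho> ^ (n - j) * v j \<le> v n" using weight_path_growth[OF v rho, of j "n - j"] n that by auto
    then have vj: "0 < v j" "v j \<le> u * ?r" using n rho by (auto simp: power_divide divide_simps mult.commute)
    have "v j powr (\<delta> + 1) \<le> (u * ?r) powr (\<delta> + 1)" using vj \<open>0 < \<delta>\<close> by (intro powr_mono2) auto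
    also have "\<dots> = u powr (\<delta> + 1) * ?r powr (\<delta> + 1)" by (rule powr_mult)
    also have "\<dots> \<le> u powr (\<delta> + 1) * ?r"
      using powr_mono'[of 1 "\<delta> + 1" ?r] r \<open>0 < \<delta>\<close> by (intro mult_left_mono) auto
    finally have "x * v j powr (\<delta> + 1) \<le> x * (u powr (\<delta> + 1) * ?r)" using \<open>0 < x\<close> by (intro mult_left_mono) auto
    then show ?thesis using u by (simp add: mult.assoc[symmetric])
  qed
  then have "(\<Sum>j\<le>n. x * v j powr (\<delta> + 1)) \<le> (\<Sum>j\<le>n. (1 / \<rho>) ^ (n - j))" by (intro sum_mono) auto
  also have "\<dots> \<le> 1 / (1 - 1 / \<rho>)" using rho by (intro sum_geometric_le) auto
  finally show ?thesis .
qed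

text \<open>
  The factors of the probability of parking on segment \<open>k\<close> and not before; the absolute value keeps
  them in \<open>[0, 1]\<close> for all real arguments.
\<close>

definition parking_factor :: "real \<Rightarrow> nat \<Rightarrow> nat \<Rightarrow> real \<times> real \<Rightarrow> ennreal" where
  "parking_factor x k i z =
     ennreal (if i = k then 1 - exp (- \<bar>x * fst z * snd z\<bar>) else exp (- \<bar>x * fst z * snd z\<bar>))"

lemma parking_factor_measurable [measurable]: "parking_factor x k i \<in> borel_measurable (borel \<Otimes>\<^sub>M borel)"
  unfolding parking_factor_def by (cases "i = k") simp_all

lemma travel_term_ge_parking_factors:
  assumes "0 < x" "0 < v (Suc n)" "v (Suc n) \<le> b" and vl: "\<And>i. i \<le> Suc n \<Longrightarrow> 0 \<le> v i \<and> 0 \<le> l i"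
  shows "ennreal (1 / (x * b)) * (\<Prod>i\<le>Suc n. parking_factor x (Suc n) i (v i, l i)) \<le> ennreal (travel_term x v l (Suc n))"
proof -
  have nn: "\<bar>x * v i * l i\<bar> = x * v i * l i" if "i \<le> Suc n" for i using vl[OF that] assms(1) by simp
  have prod: "(\<Prod>i\<le>n. parking_factor x (Suc n) i (v i, l i)) = ennreal (\<Prod>i\<le>n. exp (- (x * v i) * l i))"
    unfolding prod_ennreal[symmetric, OF exp_ge_zero]
    by (intro prod.cong) (auto simp: parking_factor_def nn)
  have P: "0 \<le> (\<Prod>i\<le>n. exp (- (x * v i) * l i))" by (intro prod_nonneg) auto
  have Q: "0 \<le> 1 - exp (- (x * v (Suc n)) * l (Suc n))" using vl[of "Suc n"] assms(1) by simp
  have "ennreal (1 / (x * b)) * (\<Prod>i\<le>Suc n. parking_factor x (Suc n) i (v i, l i))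
      = ennreal (1 / (x * b) * ((\<Prod>i\<le>n. exp (- (x * v i) * l i)) * (1 - exp (- (x * v (Suc n)) * l (Suc n)))))"
    using assms P Q nn[of "Suc n"] unfolding prod.atMost_Suc prod
    by (simp add: parking_factor_def ennreal_mult del: times_divide_eq_left times_divide_eq_right)
  also have "\<dots> \<le> ennreal (travel_term x v l (Suc n))"
  proof (rule ennreal_leI)
    have "1 / (x * b) \<le> 1 / (x * v (Suc n))" using assms by (intro divide_left_mono mult_left_mono) auto
    from mult_right_mono[OF this mult_nonneg_nonneg[OF P Q]]
    show "1 / (x * b) * ((\<Prod>i\<le>n. exp (- (x * v i) * l i)) * (1 - exp (- (x * v (Suc n)) * l (Suc n))))
        \<le> travel_term x v l (Suc n)"
      by (simp add: travel_term_def lessThan_Suc_atMost mult_ac)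
  qed
  finally show ?thesis .
qed

context hyperfractal_search
begin

text \<open>
  Given the weights, if the chain crosses the critical level at step \<open>n\<close> into the window, then the car
  parks on the segment reached and not before with probability bounded below: the factor
  \<open>exp (- (C / (1 - 1 / \<rho>)))\<close> is for not parking before, \<open>\<kappa>\<close> for parking there.
\<close>

lemma park_in_window_ge:
  assumes x: "0 < x" and u: "0 < u" "x * u powr (\<delta> + 1) = 1" and "0 < C"
    and C: "\<And>\<mu>. \<mu> \<in> {0<..1} \<Longrightarrow>
       ennreal (exp (- (C * (x * \<mu> powr (\<delta> + 1))))) \<le> (\<integral>\<^sup>+l. ennreal (exp (- \<bar>x * \<mu> * l\<bar>)) \<partial>length_law \<mu>)"
    and "0 < \<kappa>"
    and \<kappa>: "\<And>\<mu>. \<mu> \<in> {0<..1} \<Longrightarrow> 1 \<le> x * \<mu> powr (\<delta> + 1) \<Longrightarrow>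
       ennreal \<kappa> \<le> (\<integral>\<^sup>+l. ennreal (1 - exp (- \<bar>x * \<mu> * l\<bar>)) \<partial>length_law \<mu>)"
  shows "ennreal (exp (- (C / (1 - 1 / \<rho>))) * \<kappa>) * emeasure M (crossing_into_window u n)
    \<le> (\<integral>\<^sup>+\<omega>. indicator (crossing_into_window u n) \<omega>
          * (\<Prod>i\<le>Suc n. parking_factor x (Suc n) i (V i \<omega>, L i \<omega>)) \<partial>M)"
proof -
  let ?G = "crossing_into_window u n"
  let ?I = "\<lambda>i \<omega>. \<integral>\<^sup>+l. parking_factor x (Suc n) i (V i \<omega>, l) \<partial>length_law (V i \<omega>)"
  have G: "?G \<in> sets (history M V UNIV)"
    unfolding crossing_into_window_def
    by (intro sets.Int in_weight_history[where B = "{0<..u}" and i = n]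
      in_weight_history[where B = "{u<..2 * \<rho> * u}" and i = "Suc n"]) auto
  have pos: "0 < V (Suc n) \<omega>" if "\<omega> \<in> ?G" for \<omega> using that u by (auto simp: crossing_into_window_def)
  have "ennreal (exp (- (C / (1 - 1 / \<rho>))) * \<kappa>) * emeasure M ?G
      = (\<integral>\<^sup>+\<omega>. ennreal (exp (- (C / (1 - 1 / \<rho>))) * \<kappa>) * indicator ?G \<omega> \<partial>M)"
    by (rule nn_integral_cmult_indicator[symmetric, OF history_sets[OF G]])
  also have "\<dots> \<le> (\<integral>\<^sup>+\<omega>. indicator ?G \<omega> * (\<Prod>i\<le>Suc n. ?I i \<omega>) \<partial>M)"
    using AE_weight_path AE_weights_before[of "Suc n"]
  proof (intro nn_integral_mono_AE, eventually_elim)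
    case (elim \<omega>)
    show ?case
    proof (cases "\<omega> \<in> ?G")
      case True
      then have V: "0 < V n \<omega>" "V n \<omega> \<le> u" "u < V (Suc n) \<omega>" by (auto simp: crossing_into_window_def)
      have range: "V i \<omega> \<in> {0<..1}" if "i \<le> Suc n" for i using elim(4) pos[OF True] that by blast
      have "C * (\<Sum>i\<le>n. x * V i \<omega> powr (\<delta> + 1)) \<le> C * (1 / (1 - 1 / \<rho>))"
        using \<open>0 < C\<close> by (intro mult_left_mono weight_path_energy_le[OF elim(3) rho_gt_1 delta_pos x V(1,2) u(2)]) simp
      then have "exp (- (C / (1 - 1 / \<rho>))) \<le> exp (- (C * (\<Sum>i\<le>n. x * V i \<omega> powr (\<delta> + 1))))"
        by simp
      also have "\<dots> = (\<Prod>i\<le>n. exp (- (C * (x * V i \<omega> powr (\<delta> + 1)))))"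
        by (simp add: exp_sum[symmetric] sum_negf sum_distrib_left)
      also have "ennreal \<dots> = (\<Prod>i\<le>n. ennreal (exp (- (C * (x * V i \<omega> powr (\<delta> + 1))))))"
        by (simp add: prod_ennreal)
      also have "\<dots> \<le> (\<Prod>i\<le>n. ?I i \<omega>)"
        using C range by (intro prod_mono_ennreal) (simp add: parking_factor_def)
      finally have before: "ennreal (exp (- (C / (1 - 1 / \<rho>)))) \<le> (\<Prod>i\<le>n. ?I i \<omega>)" by (simp add: ennreal_leI)
      have "x * u powr (\<delta> + 1) \<le> x * V (Suc n) \<omega> powr (\<delta> + 1)"
        using x u V delta_pos by (intro mult_left_mono powr_mono2) auto
      then have "ennreal \<kappa> \<le> ?I (Suc n) \<omega>" using u \<kappa>[OF range[of "Suc n"]] by (simp add: parking_factor_def)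
      with before have "ennreal (exp (- (C / (1 - 1 / \<rho>)))) * ennreal \<kappa> \<le> (\<Prod>i\<le>Suc n. ?I i \<omega>)"
        unfolding prod.atMost_Suc by (rule mult_mono) auto
      then show ?thesis using True \<open>0 < \<kappa>\<close> by (simp add: ennreal_mult del: prod.atMost_Suc)
    qed simp
  qed
  also have "\<dots> = (\<integral>\<^sup>+\<omega>. indicator ?G \<omega> * (\<Prod>i\<le>Suc n. parking_factor x (Suc n) i (V i \<omega>, L i \<omega>)) \<partial>M)"
    by (rule nn_integral_lengths[symmetric, OF G])
       (auto simp: pos parking_factor_def intro!: ennreal_leI[where y = 1, simplified])
  finally show ?thesis .
qed

text \<open>
  At most one of the steps crosses into the window, but the terms of the distance are nonnegative, so
  it suffices to keep those terms that belong to such steps. Their denominators are at most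
  \<open>x * (2 * \<rho> * u)\<close>.
\<close>

lemma AE_path_distance_ge:
  assumes x: "0 < x" and u: "0 < u" and N: "1 < \<rho> ^ N * m"
  shows "AE \<omega> in M. (\<Sum>n<N. ennreal (1 / (x * (2 * \<rho> * u))) * (indicator (crossing_into_window u n) \<omega>
       * (\<Prod>i\<le>Suc n. parking_factor x (Suc n) i (V i \<omega>, L i \<omega>)))) \<le> ennreal (path_distance x V L \<omega>)"
  using AE_existing_segments
proof eventually_elim
  case (elim \<omega>)
  let ?t = "travel_term x (\<lambda>i. V i \<omega>) (\<lambda>i. L i \<omega>)"
  have m: "0 < m" using start_in by simp
  note num = weight_path_positive_iff[OF _ rho_gt_1 m N, of "\<lambda>n. V n \<omega>", folded num_segments_def]
  have t: "0 \<le> ?t n" if "n < num_segments V \<omega>" for n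
  proof -
    have "0 < V n \<omega>" using num(1)[of n] elim that by simp
    with elim have "\<And>i. i \<le> n \<Longrightarrow> m \<le> V i \<omega>" "\<And>i. i \<le> n \<Longrightarrow> 0 \<le> L i \<omega>" by blast+
    from travel_term_bounds[OF x m this] show ?thesis by simp
  qed
  define S where "S = {n. n < N \<and> \<omega> \<in> crossing_into_window u n}"
  have S: "0 < V (Suc n) \<omega> \<and> V (Suc n) \<omega> \<le> 2 * \<rho> * u" if "n \<in> S" for n
    using that u by (auto simp: S_def crossing_into_window_def)
  have num_S: "Suc n < num_segments V \<omega>" if "n \<in> S" for n
    using S[OF that] num(1)[of "Suc n"] elim by simp
  have "(\<Sum>n<N. ennreal (1 / (x * (2 * \<rho> * u))) * (indicator (crossing_into_window u n) \<omega>
       * (\<Prod>i\<le>Suc n. parking_factor x (Suc n) i (V i \<omega>, L i \<omega>))))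
     = (\<Sum>n\<in>S. ennreal (1 / (x * (2 * \<rho> * u))) * (\<Prod>i\<le>Suc n. parking_factor x (Suc n) i (V i \<omega>, L i \<omega>)))"
    by (rule sum.mono_neutral_cong_right) (auto simp: S_def)
  also have "\<dots> \<le> (\<Sum>n\<in>S. ennreal (?t (Suc n)))"
  proof (rule sum_mono)
    fix n assume n: "n \<in> S"
    have "0 \<le> V i \<omega> \<and> 0 \<le> L i \<omega>" if "i \<le> Suc n" for i
      using elim S[OF n] that m by force
    then show "ennreal (1 / (x * (2 * \<rho> * u))) * (\<Prod>i\<le>Suc n. parking_factor x (Suc n) i (V i \<omega>, L i \<omega>)) \<le> ennreal (?t (Suc n))"
      using travel_term_ge_parking_factors[of x "\<lambda>i. V i \<omega>" n "2 * \<rho> * u" "\<lambda>i. L i \<omega>"] S[OF n] x by blast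
  qed
  also have "\<dots> = ennreal (\<Sum>n\<in>S. ?t (Suc n))" using t num_S by (intro sum_ennreal) auto
  also have "(\<Sum>n\<in>S. ?t (Suc n)) = (\<Sum>n\<in>Suc ` S. ?t n)" by (simp add: sum.reindex)
  also have "\<dots> \<le> (\<Sum>n<num_segments V \<omega>. ?t n)" using t num_S by (intro sum_mono2) auto
  finally show ?case by (simp add: path_distance_eq ennreal_leI)
qed

text \<open>
  The three one-step estimates combined; the bound does not depend on the starting weight \<open>m\<close>.
\<close>

lemma expectation_path_distance_ge:
  assumes x: "0 < x" and u: "0 < u" "x * u powr (\<delta> + 1) = 1" "2 * \<rho> * u \<le> 1" and m: "m \<le> u"
    and "0 < q"
    and q: "\<And>\<mu> u. 0 < \<mu> \<Longrightarrow> \<mu> \<le> u \<Longrightarrow> 2 * \<rho> * u \<le> 1 \<Longrightarrow>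
       ennreal q * emeasure (next_weight_law p \<mu>) (- {0<..u}) \<le> emeasure (next_weight_law p \<mu>) {u<..2 * \<rho> * u}"
    and "0 < C"
    and C: "\<And>\<mu>. \<mu> \<in> {0<..1} \<Longrightarrow>
       ennreal (exp (- (C * (x * \<mu> powr (\<delta> + 1))))) \<le> (\<integral>\<^sup>+l. ennreal (exp (- \<bar>x * \<mu> * l\<bar>)) \<partial>length_law \<mu>)"
    and "0 < \<kappa>"
    and \<kappa>: "\<And>\<mu>. \<mu> \<in> {0<..1} \<Longrightarrow> 1 \<le> x * \<mu> powr (\<delta> + 1) \<Longrightarrow>
       ennreal \<kappa> \<le> (\<integral>\<^sup>+l. ennreal (1 - exp (- \<bar>x * \<mu> * l\<bar>)) \<partial>length_law \<mu>)"
  shows "exp (- (C / (1 - 1 / \<rho>))) * \<kappa> * q / (2 * \<rho>) / (x * u) \<le> (\<integral>\<omega>. path_distance x V L \<omega> \<partial>M)"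
proof -
  define a where "a = 1 / (x * (2 * \<rho> * u))"
  define b where "b = exp (- (C / (1 - 1 / \<rho>))) * \<kappa>"
  have ab: "0 < a" "0 < b" using x u rho_gt_1 \<open>0 < \<kappa>\<close> by (auto simp: a_def b_def)
  obtain N where N: "1 < \<rho> ^ N * m" by (rule bounded_segments)
  have [measurable]: "crossing_into_window u n \<in> events" for n unfolding crossing_into_window_def by measurable
  have "ennreal (a * b * q) = ennreal a * (ennreal b * (ennreal q * 1))"
    using ab \<open>0 < q\<close> by (simp add: ennreal_mult mult.assoc)
  also have "\<dots> \<le> ennreal a * (ennreal b * (ennreal q * (\<Sum>n<N. emeasure M (crossing u n))))"
    by (intro mult_left_mono sum_crossing_ge_1 m N) simp_all
  also have "\<dots> = (\<Sum>n<N. ennreal a * (ennreal b * (ennreal q * emeasure M (crossing u n))))"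
    by (simp add: sum_distrib_left)
  also have "\<dots> \<le> (\<Sum>n<N. ennreal a * (ennreal b * emeasure M (crossing_into_window u n)))"
    by (intro sum_mono mult_left_mono crossing_into_window_ge u q) simp_all
  also have "\<dots> \<le> (\<Sum>n<N. ennreal a * (\<integral>\<^sup>+\<omega>. indicator (crossing_into_window u n) \<omega>
       * (\<Prod>i\<le>Suc n. parking_factor x (Suc n) i (V i \<omega>, L i \<omega>)) \<partial>M))"
    unfolding b_def by (intro sum_mono mult_left_mono park_in_window_ge assms) simp_all
  also have "\<dots> = (\<integral>\<^sup>+\<omega>. (\<Sum>n<N. ennreal a * (indicator (crossing_into_window u n) \<omega>
       * (\<Prod>i\<le>Suc n. parking_factor x (Suc n) i (V i \<omega>, L i \<omega>)))) \<partial>M)"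
    by (subst nn_integral_sum) (auto intro!: sum.cong nn_integral_cmult[symmetric])
  also have "\<dots> \<le> (\<integral>\<^sup>+\<omega>. ennreal (path_distance x V L \<omega>) \<partial>M)"
    unfolding a_def by (intro nn_integral_mono_AE AE_path_distance_ge x u N)
  also have "\<dots> = ennreal (\<integral>\<omega>. path_distance x V L \<omega> \<partial>M)"
    by (intro nn_integral_eq_integral path_distance_integrable x)
  finally have "a * b * q \<le> (\<integral>\<omega>. path_distance x V L \<omega> \<partial>M)"
    using ab \<open>0 < q\<close> integral_nonneg_AE[OF path_distance_integrable(2)[OF x]] by (simp add: ennreal_le_iff)
  also have "a * b * q = exp (- (C / (1 - 1 / \<rho>))) * \<kappa> * q / (2 * \<rho>) / (x * u)"
    by (simp add: a_def b_def mult_ac)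
  finally show ?thesis .
qed

end

theorem theorem7p2:
  fixes d\<^sub>F \<delta> \<rho> :: real
    and p :: "real \<Rightarrow> real \<Rightarrow> real"
    and \<Lambda> :: "real \<Rightarrow> real measure"
    and \<eta> :: "real \<Rightarrow> real"
    and M :: "real \<Rightarrow> 'a measure"
    and V L :: "real \<Rightarrow> nat \<Rightarrow> 'a \<Rightarrow> real"
    and f :: "real \<Rightarrow> real"
  assumes "d\<^sub>F > 2"
    and "\<delta> = 1 / (d\<^sub>F - 1)"
    and "\<rho> > 1"
    and "hyperfractal_laws \<delta> \<rho> p \<Lambda> \<eta>"
    and "\<And>m. 0 < m \<Longrightarrow> m \<le> 1 \<Longrightarrow> search_path (M m) p \<Lambda> m (V m) (L m)"
    and "\<And>x. x > 0 \<Longrightarrow>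
           ((\<lambda>m. \<integral>\<omega>. path_distance x (V m) (L m) \<omega> \<partial>M m) \<longlongrightarrow> f x) (at_right 0)"
  shows "\<exists>c>0. \<exists>x\<^sub>0>0. \<forall>x\<ge>x\<^sub>0. f x \<ge> c * x powr (- 1 / d\<^sub>F)"
proof -
  have "0 < \<delta>" using assms(1,2) by simp
  moreover have "\<delta> + 1 = \<delta> * d\<^sub>F" using assms(1,2) by (simp add: field_simps)
  then have "\<delta> / (\<delta> + 1) = 1 / d\<^sub>F" using \<open>0 < \<delta>\<close> by simp
  ultimately have delta: "0 < \<delta>" "\<delta> / (\<delta> + 1) = 1 / d\<^sub>F" "0 < \<delta> + 1" by simp_all
  interpret hyperfractal_model \<delta> \<rho> p \<Lambda> \<eta>
    using assms(3,4) delta by (simp add: hyperfractal_model_def hyperfractal_model_axioms_def)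
  obtain q where q: "0 < q" "\<And>\<mu> u. 0 < \<mu> \<Longrightarrow> \<mu> \<le> u \<Longrightarrow> 2 * \<rho> * u \<le> 1 \<Longrightarrow>
       ennreal q * emeasure (next_weight_law p \<mu>) (- {0<..u}) \<le> emeasure (next_weight_law p \<mu>) {u<..2 * \<rho> * u}"
    by (rule crossing_lands_in_window) blast
  obtain C where C: "0 < C" "\<And>x \<mu>. 0 < x \<Longrightarrow> \<mu> \<in> {0<..1} \<Longrightarrow>
       ennreal (exp (- (C * (x * \<mu> powr (\<delta> + 1))))) \<le> (\<integral>\<^sup>+l. ennreal (exp (- \<bar>x * \<mu> * l\<bar>)) \<partial>length_law \<mu>)"
    by (rule not_parking_probability_ge) blast
  obtain \<kappa> where \<kappa>: "0 < \<kappa>" "\<And>x \<mu>. 0 < x \<Longrightarrow> \<mu> \<in> {0<..1} \<Longrightarrow> 1 \<le> x * \<mu> powr (\<delta> + 1) \<Longrightarrow>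
       ennreal \<kappa> \<le> (\<integral>\<^sup>+l. ennreal (1 - exp (- \<bar>x * \<mu> * l\<bar>)) \<partial>length_law \<mu>)"
    by (rule parking_probability_ge) blast
  define c where "c = exp (- (C / (1 - 1 / \<rho>))) * \<kappa> * q / (2 * \<rho>)"
  have "0 < c" using \<open>0 < q\<close> \<open>0 < \<kappa>\<close> rho_gt_1 by (simp add: c_def)
  \<comment> \<open>From this intensity on, the window above the critical weight lies below 1.\<close>
  define x0 where "x0 = (2 * \<rho>) powr (\<delta> + 1)"
  have "0 < x0" using rho_gt_1 by (simp add: x0_def)
  have "c * x powr (- 1 / d\<^sub>F) \<le> f x" if "x0 \<le> x" for x
  proof -
    have x: "0 < x" using that \<open>0 < x0\<close> by simp
    \<comment> \<open>The critical weight: a segment of weight \<open>u\<close> carries of the order of one free slot on average.\<close>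
    define u where "u = x powr (- 1 / (\<delta> + 1))"
    have "u powr (\<delta> + 1) = x powr (- 1)" using delta by (simp add: u_def powr_powr)
    then have u: "0 < u" "x * u powr (\<delta> + 1) = 1"
      using x by (auto simp: u_def powr_minus)
    have "2 * \<rho> = x0 powr (1 / (\<delta> + 1))" using rho_gt_1 delta by (simp add: x0_def powr_powr)
    also have "\<dots> \<le> x powr (1 / (\<delta> + 1))" using that \<open>0 < x0\<close> delta by (intro powr_mono2) auto
    finally have "2 * \<rho> * u \<le> x powr (1 / (\<delta> + 1)) * u" using u by (intro mult_right_mono) auto
    also have "\<dots> = 1" using x by (simp add: u_def powr_add[symmetric])
    finally have u1: "2 * \<rho> * u \<le> 1" .
    have "x * u = x powr (1 + - 1 / (\<delta> + 1))" unfolding powr_add using x by (simp add: u_def)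
    also have "1 + - 1 / (\<delta> + 1) = 1 / d\<^sub>F" unfolding delta(2)[symmetric] using delta by (simp add: divide_simps)
    finally have xu: "c / (x * u) = c * x powr (- 1 / d\<^sub>F)" by (simp add: powr_minus divide_inverse)
    have "u \<le> 1" using u1 mult_right_mono[of 1 "2 * \<rho>" u] rho_gt_1 u(1) by linarith
    have "c / (x * u) \<le> (\<integral>\<omega>. path_distance x (V m) (L m) \<omega> \<partial>M m)" if "0 < m" "m < u" for m
    proof -
      have m: "m \<in> {0<..1}" using that \<open>u \<le> 1\<close> by simp
      interpret S: search_path "M m" p \<Lambda> m "V m" "L m" using assms(5) m by simp
      interpret S: hyperfractal_search \<delta> \<rho> p \<Lambda> \<eta> "M m" m "V m" "L m"
        by unfold_locales (rule m)
      show ?thesis unfolding c_def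
        using q C \<kappa> that by (intro S.expectation_path_distance_ge[OF x u u1 _ q C(1) _ \<kappa>(1)]) (auto simp: x)
    qed
    then have "\<forall>\<^sub>F m in at_right 0. c / (x * u) \<le> (\<integral>\<omega>. path_distance x (V m) (L m) \<omega> \<partial>M m)"
      using u(1) by (auto simp: eventually_at_right_field)
    from tendsto_lowerbound[OF assms(6)[OF x] this] show ?thesis unfolding xu by simp
  qed
  with \<open>0 < c\<close> \<open>0 < x0\<close> show ?thesis by blast
qed

end
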